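(* Let $n\ge1$ and suppose $\alpha,\lambda,\sigma$ are constants with $\alpha\in(0,n+2)$, $\lambda>0$, and $\sigma>G_\alpha(\lambda)$. Let $\varphi:(0,1)\to(0,\infty)$ be a continuous function with $\lim_{t\to0^+}\varphi(t)=\infty$. Then there exists a positive function $u\in C^{2,1}(\mathbb{R}^n\times(0,1))\cap L^\lambda(\mathbb{R}^n\times(0,1))$ satisfying $$0\le u_t-\Delta u\le \Big(\iint_{\mathbb{R}^n\times(0,1)}\Phi(x-y,t-s)^{\alpha/n}u(y,s)^\lambda\,dy\,ds\Big)\,u(x,t)^\sigma\quad\text{for }(x,t)\in\mathbb{R}^n\times(0,1)$$ such that $u(0,t)\ne O(\varphi(t))$ as $t\to0^+$.
   Context: $\Phi$ is the heat kernel: $\Phi(x,t)=(4\pi t)^{-n/2}e^{-|x|^2/(4t)}$ for $t>0$ and $\Phi(x,t)=0$ for $t\le0$. For $\alpha\in(0,n+2)$, $G_\alpha:(0,\infty)\to[0,\infty)$ is defined by $G_\alpha(\lambda)=\frac{2(n+2)-\alpha}{n}-\lambda$ if $0<\lambda<\frac{n+2}{n}$ and $G_\alpha(\lambda)=\max\{0,1-\frac{\alpha-2}{n+2}\lambda\}$ if $\lambda\ge\frac{n+2}{n}$. *)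

theory Defs
  imports "HOL-Analysis.Analysis" "HOL-Library.Landau_Symbols"
begin

definition heat_kernel :: "'a::euclidean_space \<Rightarrow> real \<Rightarrow> real" where
  "heat_kernel x t = (if t > 0
     then (4 * pi * t) powr (- real DIM('a) / 2) * exp (- ((norm x)\<^sup>2) / (4 * t))
     else 0)"

definition G_alpha :: "nat \<Rightarrow> real \<Rightarrow> real \<Rightarrow> real" where
  "G_alpha n \<alpha> lam = (if lam < (real n + 2) / real n
     then (2 * (real n + 2) - \<alpha>) / real n - lam
     else max 0 (1 - (\<alpha> - 2) / (real n + 2) * lam))"

definition pdx :: "('a::euclidean_space \<Rightarrow> real \<Rightarrow> real) \<Rightarrow> 'a \<Rightarrow> 'a \<Rightarrow> real \<Rightarrow> real" where
  "pdx u i x t = deriv (\<lambda>h. u (x + h *\<^sub>R i) t) 0"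

definition pdt :: "('a::euclidean_space \<Rightarrow> real \<Rightarrow> real) \<Rightarrow> 'a \<Rightarrow> real \<Rightarrow> real" where
  "pdt u x t = deriv (\<lambda>s. u x s) t"

definition laplacian :: "('a::euclidean_space \<Rightarrow> real \<Rightarrow> real) \<Rightarrow> 'a \<Rightarrow> real \<Rightarrow> real" where
  "laplacian u x t = (\<Sum>i\<in>Basis. pdx (pdx u i) i x t)"

definition C21_on :: "real set \<Rightarrow> ('a::euclidean_space \<Rightarrow> real \<Rightarrow> real) \<Rightarrow> bool" where
  "C21_on T u \<longleftrightarrow>
     (\<forall>x. \<forall>t\<in>T.
        (\<lambda>s. u x s) differentiable (at t) \<and>
        (\<forall>i\<in>Basis. (\<lambda>h. u (x + h *\<^sub>R i) t) differentiable (at 0)) \<and>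
        (\<forall>i\<in>Basis. \<forall>j\<in>Basis. (\<lambda>h. pdx u i (x + h *\<^sub>R j) t) differentiable (at 0))) \<and>
     continuous_on (UNIV \<times> T) (\<lambda>(x, t). u x t) \<and>
     continuous_on (UNIV \<times> T) (\<lambda>(x, t). pdt u x t) \<and>
     (\<forall>i\<in>Basis. continuous_on (UNIV \<times> T) (\<lambda>(x, t). pdx u i x t)) \<and>
     (\<forall>i\<in>Basis. \<forall>j\<in>Basis. continuous_on (UNIV \<times> T) (\<lambda>(x, t). pdx (pdx u i) j x t))"

end

theory Submission
  imports Defs "HOL-Probability.Distributions"
begin

text \<open>
  The solution is a series of pulses \<open>r powr (n - a) * ramp ((t - s) / r\<^sup>2) * heat_kernel x (t - s + r\<^sup>2)\<close>:
  a heat kernel of width \<open>r\<close>, switched on in a \<open>C\<^sup>1\<close> fashion during the time interval from \<open>s\<close> to \<open>s + r\<^sup>2\<close>. The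
  heat operator only sees the derivative of the switch, so the source of a pulse is a Gaussian that
  is active during that interval only. The pulses form chains, one for each \<open>j\<close>, started at time \<open>0\<close>
  with width \<open>R / 2 ^ j\<close>, in which every pulse is \<open>L\<close> times narrower than its predecessor. At height
  \<open>r powr (- a)\<close> the predecessor alone makes the nonlocal right-hand side at least of order
  \<open>r powr (n + 2 - \<alpha> - a * (lam + \<sigma>))\<close>, which dominates the source, of order \<open>r powr (- a - 2)\<close>, as soon as
  \<open>a * (lam + \<sigma> - 1) > n + 4 - \<alpha>\<close> and \<open>R\<close> is small; for large \<open>L\<close> the Gaussian tails are compatible.
  The pulses belong to \<open>L\<^sup>\<lambda>\<close> with a uniform bound if \<open>a < n\<close> and \<open>a * lam < n + 2\<close>, and the hypothesis on
  \<open>\<sigma>\<close> says precisely that such an \<open>a\<close> exists. Each chain is finite but as long as one likes, so its last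
  pulse exceeds any multiple of \<open>\<phi>\<close> at the origin.
\<close>

subsection \<open>The heat kernel and a switching function\<close>

definition ramp :: "real \<Rightarrow> real" where
  "ramp x = 2 * ((max 0 x)\<^sup>2 - 2 * (max 0 (x - 1/2))\<^sup>2 + (max 0 (x - 1))\<^sup>2)"

text \<open>The tent function on [0, 1] with peak 2 at 1/2; its integral is 1, so that
  \<open>ramp\<close> rises from 0 to 1. Truncated powers describe both functions on the whole line
  by one formula, and the derivative reduces to that of the squared positive part.\<close>

definition ramp' :: "real \<Rightarrow> real" where
  "ramp' x = 4 * (max 0 x - 2 * max 0 (x - 1/2) + max 0 (x - 1))"

lemma has_field_derivative_pos_part_square:
  "((\<lambda>x::real. (max 0 x)\<^sup>2) has_field_derivative 2 * max 0 x) (at x)"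
proof (cases x "0::real" rule: linorder_cases)
  case less
  have "((\<lambda>x::real. 0) has_field_derivative 0) (at x)" by simp
  then have "((\<lambda>x::real. (max 0 x)\<^sup>2) has_field_derivative 0) (at x)"
    by (rule has_field_derivative_transform_within_open[where S="{..<0}"]) (use less in auto)
  then show ?thesis using less by simp
next
  case greater
  have "((\<lambda>x::real. x\<^sup>2) has_field_derivative 2 * x) (at x)"
    by (auto intro!: derivative_eq_intros)
  then have "((\<lambda>x::real. (max 0 x)\<^sup>2) has_field_derivative 2 * x) (at x)"
    by (rule has_field_derivative_transform_within_open[where S="{0<..}"]) (use greater in auto)
  then show ?thesis using greater by simp
next
  case equal
  have "((\<lambda>y::real. (max 0 y)\<^sup>2 / y) \<longlongrightarrow> 0) (at 0)"
  proof (rule Lim_null_comparison)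
    show "\<forall>\<^sub>F y in at 0. norm ((max 0 y)\<^sup>2 / y) \<le> \<bar>y::real\<bar>"
      by (rule always_eventually) (auto simp: max_def power2_eq_square)
    show "((\<lambda>y::real. \<bar>y\<bar>) \<longlongrightarrow> 0) (at 0)"
      by (intro tendsto_eq_intros) auto
  qed
  then show ?thesis using equal by (simp add: has_field_derivative_iff)
qed

lemma has_field_derivative_ramp:
  "(ramp has_field_derivative ramp' x) (at x)"
proof -
  have *: "((\<lambda>x::real. (max 0 (x - c))\<^sup>2) has_field_derivative 2 * max 0 (x - c)) (at x)" for c
  proof -
    have "((\<lambda>x. x - c) has_field_derivative 1) (at x)"
      by (auto intro!: derivative_eq_intros)
    from DERIV_chain2[OF has_field_derivative_pos_part_square this] show ?thesis by simp
  qed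
  show ?thesis
    unfolding ramp_def ramp'_def
    by (rule derivative_eq_intros has_field_derivative_pos_part_square * refl)+ simp
qed

lemma continuous_on_ramp [continuous_intros]:
  "continuous_on S f \<Longrightarrow> continuous_on S (\<lambda>x. ramp (f x))"
  unfolding ramp_def by (intro continuous_intros)

lemma continuous_on_ramp' [continuous_intros]:
  "continuous_on S f \<Longrightarrow> continuous_on S (\<lambda>x. ramp' (f x))"
  unfolding ramp'_def by (intro continuous_intros)

lemma ramp_nonpos [simp]: "x \<le> 0 \<Longrightarrow> ramp x = 0"
  by (simp add: ramp_def)

lemma ramp_ge_1 [simp]: "x \<ge> 1 \<Longrightarrow> ramp x = 1"
  by (simp add: ramp_def power2_eq_square algebra_simps)

lemma ramp'_nonpos [simp]: "x \<le> 0 \<Longrightarrow> ramp' x = 0"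
  by (simp add: ramp'_def)

lemma ramp'_ge_1 [simp]: "x \<ge> 1 \<Longrightarrow> ramp' x = 0"
  by (simp add: ramp'_def algebra_simps)

lemma ramp'_bounds: "0 \<le> ramp' x" "ramp' x \<le> 2"
  by (auto simp: ramp'_def max_def)

lemma ramp_bounds: "0 \<le> ramp x" "ramp x \<le> 1"
proof -
  have mono: "ramp x \<le> ramp y" if "x \<le> y" for x y
    using that has_field_derivative_ramp ramp'_bounds(1) DERIV_nonneg_imp_nondecreasing by metis
  show "0 \<le> ramp x" using mono[of "min x 0" x] by simp
  show "ramp x \<le> 1" using mono[of x "max x 1"] by simp
qed

section \<open>Closed forms of the derivatives of the heat kernel\<close>

definition hk_t :: "'a::euclidean_space \<Rightarrow> real \<Rightarrow> real" where
  "hk_t x t = ((norm x)\<^sup>2 / (4 * t\<^sup>2) - real DIM('a) / (2 * t)) * heat_kernel x t"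

definition hk_x :: "'a::euclidean_space \<Rightarrow> 'a \<Rightarrow> real \<Rightarrow> real" where
  "hk_x i x t = - (x \<bullet> i) / (2 * t) * heat_kernel x t"

definition hk_xx :: "'a::euclidean_space \<Rightarrow> 'a \<Rightarrow> 'a \<Rightarrow> real \<Rightarrow> real" where
  "hk_xx i j x t = ((x \<bullet> i) * (x \<bullet> j) / (4 * t\<^sup>2) - (i \<bullet> j) / (2 * t)) * heat_kernel x t"

lemma heat_kernel_nonneg: "0 \<le> heat_kernel x t"
  by (simp add: heat_kernel_def)

lemma heat_kernel_pos: "t > 0 \<Longrightarrow> 0 < heat_kernel x t"
  by (simp add: heat_kernel_def)

text \<open>This is the heat equation of the kernel: the squared coordinates add up to the squared
  norm, and each basis vector contributes one term \<open>1 / (2 * t)\<close>.\<close>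

lemma sum_hk_xx: "(\<Sum>i\<in>Basis. hk_xx i i x t) = hk_t x t"
proof -
  have "(\<Sum>i\<in>Basis. hk_xx i i x t) =
      ((\<Sum>i\<in>Basis. (x \<bullet> i) * (x \<bullet> i)) / (4 * t\<^sup>2) - real DIM('a) / (2 * t)) * heat_kernel x t"
    by (simp add: hk_xx_def sum_distrib_right[symmetric] sum_subtractf sum_divide_distrib[symmetric])
  also have "(\<Sum>i\<in>Basis. (x \<bullet> i) * (x \<bullet> i)) = (norm x)\<^sup>2"
    by (metis euclidean_inner power2_norm_eq_inner)
  finally show ?thesis by (simp add: hk_t_def)
qed

lemma has_field_derivative_heat_kernel_t:
  fixes x :: "'a::euclidean_space"
  assumes "t > 0"
  shows "(heat_kernel x has_field_derivative hk_t x t) (at t)"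
proof -
  define c where "c = - real DIM('a) / 2"
  define N where "N = (norm x)\<^sup>2"
  have e: "(4 * pi * t) powr (c - 1) = (4 * pi * t) powr c / (4 * pi * t)"
    using assms by (simp add: powr_diff)
  have 1: "((\<lambda>t. (4 * pi * t) powr c) has_field_derivative c * (4 * pi * t) powr (c - 1) * (4 * pi)) (at t)"
    using assms by (auto intro!: derivative_eq_intros)
  have 2: "((\<lambda>t. exp (- N / (4 * t))) has_field_derivative exp (- N / (4 * t)) * (N / (4 * t\<^sup>2))) (at t)"
    using assms by (auto intro!: derivative_eq_intros simp: power2_eq_square)
  have "((\<lambda>t. (4 * pi * t) powr c * exp (- N / (4 * t))) has_field_derivative
      (4 * pi * t) powr c * (exp (- N / (4 * t)) * (N / (4 * t\<^sup>2))) +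
      (c * (4 * pi * t) powr (c - 1) * (4 * pi)) * exp (- N / (4 * t))) (at t)"
    using DERIV_mult'[OF 1 2] by simp
  also have "(4 * pi * t) powr c * (exp (- N / (4 * t)) * (N / (4 * t\<^sup>2))) +
      (c * (4 * pi * t) powr (c - 1) * (4 * pi)) * exp (- N / (4 * t)) =
      (N / (4 * t\<^sup>2) + c / t) * ((4 * pi * t) powr c * exp (- N / (4 * t)))"
    unfolding e using assms by (simp add: field_simps)
  also have "\<dots> = hk_t x t"
    using assms by (simp add: hk_t_def heat_kernel_def N_def c_def)
  finally show ?thesis
    by (rule has_field_derivative_transform_within_open[where S="{0<..}"])
      (use assms in \<open>auto simp: heat_kernel_def N_def c_def\<close>)
qed

lemma norm_line_square:
  fixes x i :: "'a::real_inner"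
  shows "(norm (x + h *\<^sub>R i))\<^sup>2 = (norm x)\<^sup>2 + 2 * h * (x \<bullet> i) + h\<^sup>2 * (i \<bullet> i)"
  unfolding power2_norm_eq_inner
  by (simp add: inner_simps power2_eq_square inner_commute algebra_simps)

lemma has_field_derivative_heat_kernel_x:
  fixes x i :: "'a::euclidean_space"
  assumes "t > 0"
  shows "((\<lambda>h. heat_kernel (x + h *\<^sub>R i) t) has_field_derivative hk_x i (x + h *\<^sub>R i) t) (at h)"
proof -
  define N where "N = (norm x)\<^sup>2"
  define P where "P = (4 * pi * t) powr (- real DIM('a) / 2)"
  have "((\<lambda>h. P * exp (- (N + 2 * h * (x \<bullet> i) + h\<^sup>2 * (i \<bullet> i)) / (4 * t))) has_field_derivative
      P * (exp (- (N + 2 * h * (x \<bullet> i) + h\<^sup>2 * (i \<bullet> i)) / (4 * t)) *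
        (- (2 * (x \<bullet> i) + 2 * h * (i \<bullet> i)) / (4 * t)))) (at h)"
    using assms by (auto intro!: derivative_eq_intros simp: field_simps)
  also have "P * (exp (- (N + 2 * h * (x \<bullet> i) + h\<^sup>2 * (i \<bullet> i)) / (4 * t)) *
        (- (2 * (x \<bullet> i) + 2 * h * (i \<bullet> i)) / (4 * t))) =
      - (x \<bullet> i + h * (i \<bullet> i)) / (2 * t) * (P * exp (- (N + 2 * h * (x \<bullet> i) + h\<^sup>2 * (i \<bullet> i)) / (4 * t)))"
    using assms by (simp add: field_simps)
  finally show ?thesis
    using assms by (simp add: hk_x_def heat_kernel_def norm_line_square N_def P_def inner_simps)
qed

lemma has_field_derivative_hk_x:
  fixes x i j :: "'a::euclidean_space"
  assumes "t > 0"
  shows "((\<lambda>h. hk_x i (x + h *\<^sub>R j) t) has_field_derivative hk_xx i j (x + h *\<^sub>R j) t) (at h)"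
proof -
  define E where "E = (\<lambda>h. heat_kernel (x + h *\<^sub>R j) t)"
  define E' where "E' = hk_x j (x + h *\<^sub>R j) t"
  have E': "E' = - (x \<bullet> j + h * (j \<bullet> j)) / (2 * t) * E h"
    by (simp add: E'_def E_def hk_x_def inner_simps)
  have 1: "(E has_field_derivative E') (at h)"
    unfolding E_def E'_def by (rule has_field_derivative_heat_kernel_x[OF assms])
  have 2: "((\<lambda>h. - (x \<bullet> i + h * (j \<bullet> i)) / (2 * t)) has_field_derivative - (j \<bullet> i) / (2 * t)) (at h)"
    using assms by (auto intro!: derivative_eq_intros)
  have "((\<lambda>h. - (x \<bullet> i + h * (j \<bullet> i)) / (2 * t) * E h) has_field_derivative
      - (x \<bullet> i + h * (j \<bullet> i)) / (2 * t) * E' + - (j \<bullet> i) / (2 * t) * E h) (at h)"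
    by (rule DERIV_mult'[OF 2 1])
  also have "- (x \<bullet> i + h * (j \<bullet> i)) / (2 * t) * E' + - (j \<bullet> i) / (2 * t) * E h =
      ((x \<bullet> i + h * (j \<bullet> i)) * (x \<bullet> j + h * (j \<bullet> j)) / (4 * t\<^sup>2) - (j \<bullet> i) / (2 * t)) * E h"
    unfolding E' using assms by (simp add: field_simps power2_eq_square)
  finally show ?thesis
    by (simp add: hk_x_def hk_xx_def E_def inner_simps inner_commute)
qed

lemma continuous_on_heat_kernel:
  "continuous_on (UNIV \<times> {0<..}) (\<lambda>(x::'a::euclidean_space, t). heat_kernel x t)"
proof -
  have "continuous_on (UNIV \<times> {0<..}) (\<lambda>p::'a\<times>real. 
    (4 * pi * snd p) powr (- real DIM('a) / 2) * exp (- ((norm (fst p))\<^sup>2) / (4 * snd p)))"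
    by (intro continuous_intros) auto
  then show ?thesis
    by (rule continuous_on_eq) (auto simp: heat_kernel_def)
qed

lemma continuous_on_hk:
  "continuous_on (UNIV \<times> {0<..}) (\<lambda>(x::'a::euclidean_space, t). hk_t x t)"
  "continuous_on (UNIV \<times> {0<..}) (\<lambda>(x::'a::euclidean_space, t). hk_x i x t)"
  "continuous_on (UNIV \<times> {0<..}) (\<lambda>(x::'a::euclidean_space, t). hk_xx i j x t)"
proof -
  have k: "continuous_on (UNIV \<times> {0<..}) (\<lambda>p::'a\<times>real. heat_kernel (fst p) (snd p))"
    using continuous_on_heat_kernel by (simp add: case_prod_unfold)
  have nz: "\<forall>p\<in>UNIV \<times> {0<..}. 4 * (snd (p::'a\<times>real))\<^sup>2 \<noteq> 0" "\<forall>p\<in>UNIV \<times> {0<..}. 2 * snd (p::'a\<times>real) \<noteq> 0"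
    by auto
  show "continuous_on (UNIV \<times> {0<..}) (\<lambda>(x::'a, t). hk_t x t)"
    unfolding hk_t_def case_prod_unfold by (intro continuous_on_mult continuous_on_divide continuous_on_diff k nz continuous_intros)
  show "continuous_on (UNIV \<times> {0<..}) (\<lambda>(x::'a, t). hk_x i x t)"
    unfolding hk_x_def case_prod_unfold by (intro continuous_on_mult continuous_on_divide continuous_on_minus k nz continuous_intros)
  show "continuous_on (UNIV \<times> {0<..}) (\<lambda>(x::'a, t). hk_xx i j x t)"
    unfolding hk_xx_def case_prod_unfold by (intro continuous_on_mult continuous_on_divide continuous_on_diff k nz continuous_intros)
qed

section \<open>Bounds uniform in space and away from time zero\<close>

definition bounded_for_late :: "('a \<Rightarrow> real \<Rightarrow> real) \<Rightarrow> bool" where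
  "bounded_for_late K \<longleftrightarrow> (\<forall>c>0. \<exists>B. \<forall>x. \<forall>t\<ge>c. \<bar>K x t\<bar> \<le> B)"

lemma quadratic_times_exp_le:
  fixes x :: "'a::euclidean_space"
  assumes "c > 0" "t \<ge> c"
  shows "(norm x)\<^sup>2 / (4 * t) * heat_kernel x t \<le> (4 * pi * c) powr (- real DIM('a) / 2)"
    and "heat_kernel x t \<le> (4 * pi * c) powr (- real DIM('a) / 2)"
proof -
  define y where "y = (norm x)\<^sup>2 / (4 * t)"
  have y: "y \<ge> 0" using assms by (simp add: y_def)
  have "y * exp (- y) \<le> 1"
    using exp_ge_add_one_self[of y] by (simp add: exp_minus field_simps) (use exp_ge_add_one_self[of y] in linarith)
  moreover have P: "(4 * pi * t) powr (- real DIM('a) / 2) \<le> (4 * pi * c) powr (- real DIM('a) / 2)"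
    using assms by (intro powr_mono2') auto
  ultimately have "(y * exp (- y)) * (4 * pi * t) powr (- real DIM('a) / 2) \<le> 1 * (4 * pi * c) powr (- real DIM('a) / 2)"
    using y by (intro mult_mono) auto
  then show "(norm x)\<^sup>2 / (4 * t) * heat_kernel x t \<le> (4 * pi * c) powr (- real DIM('a) / 2)"
    using assms by (simp add: heat_kernel_def y_def mult_ac)
  have "exp (-y) * (4 * pi * t) powr (- real DIM('a) / 2) \<le> 1 * (4 * pi * c) powr (- real DIM('a) / 2)"
    using y P by (intro mult_mono) auto
  then show "heat_kernel x t \<le> (4 * pi * c) powr (- real DIM('a) / 2)"
    using assms by (simp add: heat_kernel_def y_def mult_ac)
qed

text \<open>Every kernel in use is the heat kernel times a factor of at most quadratic growth in
  \<open>x\<close>. With \<open>y = (norm x)\<^sup>2 / (4 * t)\<close> the quadratic part is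
  absorbed by \<open>y * exp (- y) \<le> 1\<close>, and the remaining bounds decrease in
  \<open>t\<close>. They feed the Weierstrass test for the series of pulses.\<close>

lemma bounded_for_late_quadratic:
  fixes K :: "'a::euclidean_space \<Rightarrow> real \<Rightarrow> real"
  assumes "\<And>x t. t > 0 \<Longrightarrow> \<bar>K x t\<bar> \<le> (A * ((norm x)\<^sup>2 / (4 * t)) / t + D / t + D) * heat_kernel x t"
    and "A \<ge> 0" "D \<ge> 0"
  shows "bounded_for_late K"
  unfolding bounded_for_late_def
proof (intro allI impI)
  fix c :: real assume c: "c > 0"
  let ?M = "(4 * pi * c) powr (- real DIM('a) / 2)"
  have "\<bar>K x t\<bar> \<le> A / c * ?M + (D / c + D) * ?M" if t: "t \<ge> c" for x t
  proof -
    have "\<bar>K x t\<bar> \<le> A / t * ((norm x)\<^sup>2 / (4 * t) * heat_kernel x t) + (D / t + D) * heat_kernel x t"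
      using assms(1)[of t x] t c by (simp add: algebra_simps)
    also have "\<dots> \<le> A / c * ?M + (D / c + D) * ?M"
      using t c assms(2,3) quadratic_times_exp_le[OF c t, of x]
      by (intro add_mono mult_mono divide_left_mono) (auto simp: heat_kernel_nonneg)
    finally show ?thesis .
  qed
  then show "\<exists>B. \<forall>x. \<forall>t\<ge>c. \<bar>K x t\<bar> \<le> B" by blast
qed

lemma bounded_for_late_heat_kernel: "bounded_for_late (heat_kernel :: 'a::euclidean_space \<Rightarrow> _)"
proof (rule bounded_for_late_quadratic)
  fix x :: 'a and t :: real assume "t > 0"
  then have "1 * heat_kernel x t \<le> (1 / t + 1) * heat_kernel x t"
    by (intro mult_right_mono heat_kernel_nonneg) auto
  then show "\<bar>heat_kernel x t\<bar> \<le> (0 * ((norm x)\<^sup>2 / (4 * t)) / t + 1 / t + 1) * heat_kernel x t"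
    by (simp add: heat_kernel_nonneg)
qed auto

lemma bounded_for_late_hk_t: "bounded_for_late (hk_t :: 'a::euclidean_space \<Rightarrow> _)"
proof (rule bounded_for_late_quadratic)
  fix x :: 'a and t :: real assume t: "t > 0"
  have "\<bar>(norm x)\<^sup>2 / (4 * t\<^sup>2) - real DIM('a) / (2 * t)\<bar> \<le> (norm x)\<^sup>2 / (4 * t\<^sup>2) + real DIM('a) / (2 * t)"
    using t by (intro abs_leI) (auto simp: field_simps)
  also have "\<dots> \<le> 1 * ((norm x)\<^sup>2 / (4 * t)) / t + real DIM('a) / t + real DIM('a)"
  proof -
    have "(norm x)\<^sup>2 / (4 * t\<^sup>2) = 1 * ((norm x)\<^sup>2 / (4 * t)) / t"
      by (simp add: power2_eq_square)
    moreover have "real DIM('a) / (2 * t) \<le> real DIM('a) / t"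
      using t by (intro divide_left_mono) auto
    ultimately show ?thesis using of_nat_0_le_iff[of "DIM('a)"] by linarith
  qed
  finally show "\<bar>hk_t x t\<bar> \<le> (1 * ((norm x)\<^sup>2 / (4 * t)) / t + real DIM('a) / t + real DIM('a)) * heat_kernel x t"
    unfolding hk_t_def abs_mult[of _ "heat_kernel x t"] abs_of_nonneg[OF heat_kernel_nonneg]
    by (rule mult_right_mono) (rule heat_kernel_nonneg)
qed auto

lemma bounded_for_late_hk_x:
  assumes "i \<in> Basis"
  shows "bounded_for_late (hk_x i :: 'a::euclidean_space \<Rightarrow> _)"
proof (rule bounded_for_late_quadratic)
  fix x :: 'a and t :: real assume t: "t > 0"
  have "\<bar>x \<bullet> i\<bar> \<le> norm x" using assms by (rule Basis_le_norm)
  \<comment> \<open>The linear factor is brought into the quadratic form by the inequality of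
    arithmetic and geometric means for \<open>norm x\<close> and \<open>t\<close>.\<close>
  moreover have "2 * norm x \<le> (norm x)\<^sup>2 / t + t"
    using t sum_squares_bound[of "norm x" t] by (simp add: field_simps power2_eq_square)
  ultimately have "2 * \<bar>x \<bullet> i\<bar> / t \<le> ((norm x)\<^sup>2 / t + t) / t" 
    using t by (intro divide_right_mono) auto
  also have "\<dots> = 4 * (1 * ((norm x)\<^sup>2 / (4 * t)) / t) + 1"
    using t by (simp add: field_simps)
  finally have "4 * \<bar>- (x \<bullet> i) / (2 * t)\<bar> \<le> 4 * (1 * ((norm x)\<^sup>2 / (4 * t)) / t) + 1"
    using t by simp
  moreover have "1 / t \<ge> 0" using t by simp
  ultimately have "\<bar>- (x \<bullet> i) / (2 * t)\<bar> \<le> (1 * ((norm x)\<^sup>2 / (4 * t)) / t + 1 / t + 1)"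
    by linarith
  then show "\<bar>hk_x i x t\<bar> \<le> (1 * ((norm x)\<^sup>2 / (4 * t)) / t + 1 / t + 1) * heat_kernel x t"
    unfolding hk_x_def abs_mult[of _ "heat_kernel x t"] abs_of_nonneg[OF heat_kernel_nonneg]
    by (rule mult_right_mono) (rule heat_kernel_nonneg)
qed auto

lemma bounded_for_late_hk_xx:
  assumes "i \<in> Basis" "j \<in> Basis"
  shows "bounded_for_late (hk_xx i j :: 'a::euclidean_space \<Rightarrow> _)"
proof (rule bounded_for_late_quadratic)
  fix x :: 'a and t :: real assume t: "t > 0"
  have "\<bar>(x \<bullet> i) * (x \<bullet> j)\<bar> \<le> (norm x)\<^sup>2"
    unfolding abs_mult power2_eq_square using assms by (intro mult_mono Basis_le_norm) auto
  then have 1: "\<bar>(x \<bullet> i) * (x \<bullet> j) / (4 * t\<^sup>2)\<bar> \<le> 1 * ((norm x)\<^sup>2 / (4 * t)) / t"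
    using t by (simp add: field_simps power2_eq_square)
  have "\<bar>i \<bullet> j\<bar> \<le> 1" using assms by (simp add: inner_Basis)
  then have "\<bar>(i \<bullet> j) / (2 * t)\<bar> \<le> 1 / t + 1"
    using t by (simp add: field_simps)
  with 1 have "\<bar>(x \<bullet> i) * (x \<bullet> j) / (4 * t\<^sup>2) - (i \<bullet> j) / (2 * t)\<bar> \<le> 1 * ((norm x)\<^sup>2 / (4 * t)) / t + 1 / t + 1"
    by linarith
  then show "\<bar>hk_xx i j x t\<bar> \<le> (1 * ((norm x)\<^sup>2 / (4 * t)) / t + 1 / t + 1) * heat_kernel x t"
    unfolding hk_xx_def abs_mult[of _ "heat_kernel x t"] abs_of_nonneg[OF heat_kernel_nonneg]
    by (rule mult_right_mono) (rule heat_kernel_nonneg)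
qed auto

subsection \<open>Series of switched heat kernels\<close>

definition ramped :: "('a \<Rightarrow> real \<Rightarrow> real) \<Rightarrow> real \<Rightarrow> real \<Rightarrow> 'a \<Rightarrow> real \<Rightarrow> real" where
  "ramped K s r x t = ramp ((t - s) / r\<^sup>2) * K x (t - s + r\<^sup>2)"

text \<open>The part of the time derivative of a pulse in which the switch is differentiated. By the
  heat equation, for \<open>r > 0\<close> it is all that the heat operator leaves of
  \<open>ramped heat_kernel s r\<close>.\<close>

definition source :: "real \<Rightarrow> real \<Rightarrow> 'a::euclidean_space \<Rightarrow> real \<Rightarrow> real" where
  "source s r x t = ramp' ((t - s) / r\<^sup>2) / r\<^sup>2 * heat_kernel x (t - s + r\<^sup>2)"

lemma ramped_before [simp]: "t \<le> s \<Longrightarrow> ramped K s r x t = 0"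
  by (simp add: ramped_def divide_nonpos_nonneg)

lemma ramped_after: "r > 0 \<Longrightarrow> s + r\<^sup>2 \<le> t \<Longrightarrow> ramped K s r x t = K x (t - s + r\<^sup>2)"
  by (simp add: ramped_def)

lemma source_before [simp]: "t \<le> s \<Longrightarrow> source s r x t = 0"
  by (simp add: source_def divide_nonpos_nonneg)

lemma source_after [simp]: "r > 0 \<Longrightarrow> s + r\<^sup>2 \<le> t \<Longrightarrow> source s r x t = 0"
  by (simp add: source_def)

lemma source_nonneg: "0 \<le> source s r x t"
  by (simp add: source_def ramp'_bounds heat_kernel_nonneg)

lemma ramped_heat_kernel_nonneg: "0 \<le> ramped heat_kernel s r x t"
  by (simp add: ramped_def ramp_bounds heat_kernel_nonneg)

text \<open>The kernel is known to be continuous at positive ages only. Since \<open>g\<close>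
  vanishes up to time \<open>s\<close>, the age may be replaced by
  \<open>max (t - s) 0 + r\<^sup>2\<close>, which stays positive, without changing the
  product.\<close>

lemma continuous_on_cutoff:
  fixes K :: "'a::euclidean_space \<Rightarrow> real \<Rightarrow> real"
  assumes K: "continuous_on (UNIV \<times> {0<..}) (\<lambda>(x, t). K x t)" and "r > 0"
    and g: "continuous_on UNIV g" "\<And>t. t \<le> s \<Longrightarrow> g t = 0"
  shows "continuous_on UNIV (\<lambda>(x, t). g t * K x (t - s + r\<^sup>2))"
proof -
  have "continuous_on UNIV (\<lambda>p::'a\<times>real. (\<lambda>(x, t). K x t) (fst p, max (snd p - s) 0 + r\<^sup>2))"
    using assms(2)
    by (intro continuous_on_compose2[OF K] continuous_intros) (auto intro!: add_nonneg_pos)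
  moreover have "continuous_on UNIV (\<lambda>p::'a\<times>real. g (snd p))"
    by (intro continuous_on_compose2[OF g(1)] continuous_intros) auto
  ultimately have "continuous_on UNIV (\<lambda>p::'a\<times>real. g (snd p) * K (fst p) (max (snd p - s) 0 + r\<^sup>2))"
    by (intro continuous_on_mult) auto
  moreover have "g t * K x (max (t - s) 0 + r\<^sup>2) = g t * K x (t - s + r\<^sup>2)" for x t
    by (cases "t \<le> s") (auto simp: g)
  ultimately show ?thesis by (simp add: case_prod_unfold)
qed

lemma continuous_on_ramped:
  fixes K :: "'a::euclidean_space \<Rightarrow> real \<Rightarrow> real"
  assumes "continuous_on (UNIV \<times> {0<..}) (\<lambda>(x, t). K x t)" "r > 0"
  shows "continuous_on UNIV (\<lambda>(x, t). ramped K s r x t)"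
  unfolding ramped_def using assms
  by (intro continuous_on_cutoff continuous_intros) (auto simp: divide_nonpos_nonneg)

lemma continuous_on_source:
  assumes "r > 0"
  shows "continuous_on UNIV (\<lambda>(x::'a::euclidean_space, t). source s r x t)"
  unfolding source_def using assms
  by (intro continuous_on_cutoff continuous_on_heat_kernel continuous_intros) (auto simp: divide_nonpos_nonneg)

lemma has_field_derivative_ramped_x:
  fixes K K' :: "'a::euclidean_space \<Rightarrow> real \<Rightarrow> real"
  assumes "\<And>x t h. t > 0 \<Longrightarrow> ((\<lambda>h. K (x + h *\<^sub>R i) t) has_field_derivative K' (x + h *\<^sub>R i) t) (at h)"
    and "r > 0"
  shows "((\<lambda>h. ramped K s r (x + h *\<^sub>R i) t) has_field_derivative ramped K' s r (x + h *\<^sub>R i) t) (at h)"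
proof (cases "t \<le> s")
  case False
  then have "t - s + r\<^sup>2 > 0" using assms(2) by (simp add: add_pos_pos)
  then show ?thesis unfolding ramped_def by (intro DERIV_cmult assms(1))
qed simp

lemma has_field_derivative_ramped_t:
  fixes x :: "'a::euclidean_space"
  assumes "r > 0"
  shows "(ramped heat_kernel s r x has_field_derivative source s r x t + ramped hk_t s r x t) (at t)"
proof (cases "t < s")
  case True
  have "((\<lambda>t. 0::real) has_field_derivative 0) (at t)" by simp
  then have "(ramped heat_kernel s r x has_field_derivative 0) (at t)"
    by (rule has_field_derivative_transform_within_open[where S="{..<s}"]) (use True in auto)
  then show ?thesis using True by simp
next
  case False
  \<comment> \<open>At \<open>t = s\<close> the age is still \<open>r\<^sup>2\<close>, so the
    product rule covers the starting time as well.\<close>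
  then have pos: "t - s + r\<^sup>2 > 0" using assms by (simp add: add_nonneg_pos)
  have "((\<lambda>t. (t - s) / r\<^sup>2) has_field_derivative 1 / r\<^sup>2) (at t)"
    using assms by (auto intro!: derivative_eq_intros simp: field_simps)
  note 1 = DERIV_chain2[OF has_field_derivative_ramp this]
  have "((\<lambda>t. t - s + r\<^sup>2) has_field_derivative 1) (at t)"
    by (auto intro!: derivative_eq_intros)
  note 2 = DERIV_chain2[OF has_field_derivative_heat_kernel_t[OF pos] this]
  show ?thesis
    using DERIV_mult'[OF 1 2, of x] unfolding ramped_def[abs_def] source_def by (simp add: add.commute)
qed

text \<open>By \<open>late\<close>, after any positive time only finitely many terms are still being
  switched on; the alternative \<open>d m = 0\<close> accounts for terms that are cut off. Pulses
  may accumulate at time zero, but on \<open>t > \<tau>\<close> the tail consists of plain heat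
  kernels controlled by \<open>d_summable\<close>, and the source is a finite sum.\<close>

locale ramped_series =
  fixes d s r :: "nat \<Rightarrow> real"
  assumes d_nonneg: "\<And>m. d m \<ge> 0" and d_summable: "summable d" and r_pos: "\<And>m. r m > 0"
    and late: "\<And>\<tau>. \<tau> > 0 \<Longrightarrow> \<forall>\<^sub>F m in sequentially. d m = 0 \<or> s m + (r m)\<^sup>2 \<le> \<tau>"
begin

definition ser :: "('a \<Rightarrow> real \<Rightarrow> real) \<Rightarrow> 'a \<Rightarrow> real \<Rightarrow> real" where
  "ser K x t = (\<Sum>m. d m * ramped K (s m) (r m) x t)"

definition src :: "'a::euclidean_space \<Rightarrow> real \<Rightarrow> real" where
  "src x t = (\<Sum>m. d m * source (s m) (r m) x t)"

lemma eventually_ramped_bound: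
  assumes "bounded_for_late K" "\<tau> > 0"
  obtains B where
    "\<forall>\<^sub>F m in sequentially. \<forall>x. \<forall>t>\<tau>. \<bar>d m * ramped K (s m) (r m) x t\<bar> \<le> d m * B"
proof -
  from assms obtain B where B: "\<bar>K x t\<bar> \<le> B" if "t \<ge> \<tau> / 2" for x t
    unfolding bounded_for_late_def by (meson half_gt_zero)
  \<comment> \<open>Half of the time is kept in reserve: a pulse that is fully on by
    \<open>\<tau> / 2\<close> has age at least \<open>\<tau> / 2\<close> when
    \<open>t > \<tau>\<close>, which bounds the kernel independently of the pulse.\<close>
  have "\<forall>\<^sub>F m in sequentially. d m = 0 \<or> s m + (r m)\<^sup>2 \<le> \<tau> / 2"
    by (rule late) (use assms(2) in simp)
  then have "\<forall>\<^sub>F m in sequentially. \<forall>x. \<forall>t>\<tau>. \<bar>d m * ramped K (s m) (r m) x t\<bar> \<le> d m * B"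
  proof eventually_elim
    case (elim m)
    have "\<bar>ramped K (s m) (r m) x t\<bar> \<le> B" if "s m + (r m)\<^sup>2 \<le> \<tau> / 2" "t > \<tau>" for x t
    proof -
      have "t - s m + (r m)\<^sup>2 \<ge> \<tau> / 2"
        using that assms(2) zero_le_power2[of "r m"] by linarith
      then show ?thesis using that B r_pos assms(2) by (simp add: ramped_after)
    qed
    then show ?case using elim d_nonneg[of m]
      by (cases "d m = 0") (auto simp: abs_mult intro!: mult_left_mono)
  qed
  then show ?thesis by (rule that)
qed

lemma eventually_source_0:
  assumes "\<tau> > 0"
  shows "\<forall>\<^sub>F m in sequentially. \<forall>x::'a::euclidean_space. \<forall>t>\<tau>. d m * source (s m) (r m) x t = 0"
  using late[OF assms] by eventually_elim (auto simp: r_pos)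

lemma summable_ramped:
  assumes "bounded_for_late K" "t > 0"
  shows "summable (\<lambda>m. d m * ramped K (s m) (r m) x t)"
proof -
  obtain B where "\<forall>\<^sub>F m in sequentially. \<forall>x. \<forall>t'>t/2. \<bar>d m * ramped K (s m) (r m) x t'\<bar> \<le> d m * B"
    using eventually_ramped_bound[OF assms(1), of "t/2"] assms(2) by auto
  then have "\<forall>\<^sub>F m in sequentially. norm (d m * ramped K (s m) (r m) x t) \<le> d m * B"
    by eventually_elim (use assms(2) in simp)
  then show ?thesis
    by (rule summable_comparison_test_ev) (intro summable_mult2 d_summable)
qed

lemma summable_source:
  fixes x :: "'a::euclidean_space"
  assumes "t > 0"
  shows "summable (\<lambda>m. d m * source (s m) (r m) x t)"
proof -
  have "\<forall>\<^sub>F m in sequentially. norm (d m * source (s m) (r m) x t) \<le> 0"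
    by (rule eventually_mono[OF eventually_source_0[of "t/2", where 'a='a]]) (use assms in auto)
  then show ?thesis by (rule summable_comparison_test_ev) simp
qed

text \<open>The majorants are available on \<open>t > \<tau>\<close> for fixed positive
  \<open>\<tau>\<close>; for continuity at a point of time \<open>t\<close> the value
  \<open>t / 2\<close> is used.\<close>

lemma continuous_on_series_pos:
  fixes f :: "nat \<Rightarrow> 'a::euclidean_space \<Rightarrow> real \<Rightarrow> real"
  assumes cont: "\<And>m. continuous_on UNIV (\<lambda>(x, t). f m x t)"
    and bnd: "\<And>\<tau>. \<tau> > 0 \<Longrightarrow> \<exists>M. summable M \<and> (\<forall>\<^sub>F m in sequentially. \<forall>x. \<forall>t>\<tau>. \<bar>f m x t\<bar> \<le> M m)"
  shows "continuous_on (UNIV \<times> {0<..}) (\<lambda>(x, t). \<Sum>m. f m x t)"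
proof -
  have "isCont (\<lambda>(x, t). \<Sum>m. f m x t) (x, t)" if "t > 0" for x t
  proof -
    let ?A = "UNIV \<times> {t/2<..} :: ('a \<times> real) set"
    obtain M where M: "summable M" "\<forall>\<^sub>F m in sequentially. \<forall>x. \<forall>t'>t/2. \<bar>f m x t'\<bar> \<le> M m"
      using bnd[OF half_gt_zero[OF \<open>t > 0\<close>]] by blast
    have "uniform_limit ?A (\<lambda>n p. \<Sum>i<n. f i (fst p) (snd p)) (\<lambda>p. \<Sum>m. f m (fst p) (snd p)) sequentially"
      by (rule Weierstrass_m_test_ev[OF _ M(1)]) (use M(2) in \<open>eventually_elim, auto\<close>)
    then have "continuous_on ?A (\<lambda>p. \<Sum>m. f m (fst p) (snd p))"
      by (rule uniform_limit_theorem[rotated])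
        (use cont in \<open>auto intro!: always_eventually continuous_on_sum simp: case_prod_unfold intro: continuous_on_subset\<close>)
    moreover have "open ?A" by (intro open_Times) auto
    ultimately show ?thesis using that
      by (auto simp: continuous_on_eq_continuous_at case_prod_unfold)
  qed
  then show ?thesis by (auto intro!: continuous_at_imp_continuous_on)
qed

lemma continuous_on_ser:
  fixes K :: "'a::euclidean_space \<Rightarrow> real \<Rightarrow> real"
  assumes "continuous_on (UNIV \<times> {0<..}) (\<lambda>(x, t). K x t)" "bounded_for_late K"
  shows "continuous_on (UNIV \<times> {0<..}) (\<lambda>(x, t). ser K x t)"
  unfolding ser_def
proof (rule continuous_on_series_pos)
  show "continuous_on UNIV (\<lambda>(x, t). d m * ramped K (s m) (r m) x t)" for m
    using continuous_on_ramped[OF assms(1) r_pos, of "s m" m]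
    by (auto simp: case_prod_unfold intro!: continuous_intros)
  show "\<exists>M. summable M \<and> (\<forall>\<^sub>F m in sequentially. \<forall>x. \<forall>t>\<tau>. \<bar>d m * ramped K (s m) (r m) x t\<bar> \<le> M m)"
    if tau: "\<tau> > 0" for \<tau>
  proof -
    obtain B where "\<forall>\<^sub>F m in sequentially. \<forall>x. \<forall>t>\<tau>. \<bar>d m * ramped K (s m) (r m) x t\<bar> \<le> d m * B"
      by (rule eventually_ramped_bound[OF assms(2) tau])
    moreover have "summable (\<lambda>m. d m * B)" by (intro summable_mult2 d_summable)
    ultimately show ?thesis by blast
  qed
qed

lemma continuous_on_src:
  "continuous_on (UNIV \<times> {0<..}) (\<lambda>(x::'a::euclidean_space, t). src x t)"
  unfolding src_def
proof (rule continuous_on_series_pos)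
  show "continuous_on UNIV (\<lambda>(x::'a, t). d m * source (s m) (r m) x t)" for m
    using continuous_on_source[OF r_pos, of "s m" m]
    by (auto simp: case_prod_unfold intro!: continuous_intros)
  show "\<exists>M. summable M \<and> (\<forall>\<^sub>F m in sequentially. \<forall>x::'a. \<forall>t>\<tau>. \<bar>d m * source (s m) (r m) x t\<bar> \<le> M m)"
    if "\<tau> > 0" for \<tau>
    by (rule exI[of _ "\<lambda>_. 0"]) (use eventually_source_0[OF that, where 'a='a] in simp)
qed

lemma has_field_derivative_ser_x:
  fixes K K' :: "'a::euclidean_space \<Rightarrow> real \<Rightarrow> real"
  assumes "\<And>x t h. t > 0 \<Longrightarrow> ((\<lambda>h. K (x + h *\<^sub>R i) t) has_field_derivative K' (x + h *\<^sub>R i) t) (at h)"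
    and "bounded_for_late K" "bounded_for_late K'" "t > 0"
  shows "((\<lambda>h. ser K (x + h *\<^sub>R i) t) has_field_derivative ser K' (x + h *\<^sub>R i) t) (at h)"
  unfolding ser_def
proof (rule has_field_derivative_series'[where S=UNIV and ?x0.0=0])
  fix m :: nat and h :: real
  show "((\<lambda>h. d m * ramped K (s m) (r m) (x + h *\<^sub>R i) t) has_field_derivative
      d m * ramped K' (s m) (r m) (x + h *\<^sub>R i) t) (at h)"
    by (intro DERIV_cmult has_field_derivative_ramped_x assms(1) r_pos)
next
  obtain B where B: "\<forall>\<^sub>F m in sequentially. \<forall>x. \<forall>t'>t/2. \<bar>d m * ramped K' (s m) (r m) x t'\<bar> \<le> d m * B"
    using eventually_ramped_bound[OF assms(3), of "t/2"] assms(4) by auto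
  show "uniformly_convergent_on UNIV (\<lambda>n h. \<Sum>m<n. d m * ramped K' (s m) (r m) (x + h *\<^sub>R i) t)"
    by (rule Weierstrass_m_test'_ev[where M="\<lambda>m. d m * B"])
      (use B assms(4) in \<open>auto intro: summable_mult2 d_summable elim: eventually_mono\<close>)
qed (auto intro!: summable_ramped assms)

text \<open>The series is differentiated term by term beyond \<open>t / 2\<close>. There all but
  finitely many sources vanish, so the bound for \<open>hk_t\<close> alone majorizes the
  derivatives.\<close>

lemma has_field_derivative_ser_t:
  fixes x :: "'a::euclidean_space"
  assumes "t > 0"
  shows "(ser heat_kernel x has_field_derivative src x t + ser hk_t x t) (at t)"
proof -
  have "((\<lambda>t. \<Sum>m. d m * ramped heat_kernel (s m) (r m) x t) has_field_derivative
      (\<Sum>m. d m * (source (s m) (r m) x t + ramped hk_t (s m) (r m) x t))) (at t)"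
  proof (rule has_field_derivative_series'[where S="{t/2<..}" and ?x0.0=t])
    fix m :: nat and t' :: real assume "t' \<in> {t/2<..}"
    show "((\<lambda>t. d m * ramped heat_kernel (s m) (r m) x t) has_field_derivative
        d m * (source (s m) (r m) x t' + ramped hk_t (s m) (r m) x t')) (at t' within {t/2<..})"
      by (intro DERIV_cmult has_field_derivative_at_within[OF has_field_derivative_ramped_t] r_pos)
  next
    obtain B where B: "\<forall>\<^sub>F m in sequentially. \<forall>x::'a. \<forall>t'>t/2. \<bar>d m * ramped hk_t (s m) (r m) x t'\<bar> \<le> d m * B"
      using eventually_ramped_bound[OF bounded_for_late_hk_t, of "t/2"] assms by auto
    have "\<forall>\<^sub>F m in sequentially. \<forall>x::'a. \<forall>t'>t/2. d m * source (s m) (r m) x t' = 0"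
      using eventually_source_0[of "t/2"] assms by simp
    with B have "\<forall>\<^sub>F m in sequentially. \<forall>t'\<in>{t/2<..}.
        norm (d m * (source (s m) (r m) x t' + ramped hk_t (s m) (r m) x t')) \<le> d m * B"
    proof eventually_elim
      case (elim m)
      then show ?case unfolding distrib_left by (metis add_0 greaterThan_iff real_norm_def)
    qed
    then show "uniformly_convergent_on {t/2<..}
        (\<lambda>n t'. \<Sum>m<n. d m * (source (s m) (r m) x t' + ramped hk_t (s m) (r m) x t'))"
      by (rule Weierstrass_m_test'_ev) (intro summable_mult2 d_summable)
  qed (use assms in \<open>auto intro!: summable_ramped bounded_for_late_heat_kernel simp: interior_open\<close>)
  moreover have "(\<Sum>m. d m * (source (s m) (r m) x t + ramped hk_t (s m) (r m) x t)) = src x t + ser hk_t x t"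
    unfolding src_def ser_def distrib_left
    by (intro suminf_add[symmetric] summable_source summable_ramped bounded_for_late_hk_t assms)
  ultimately show ?thesis unfolding ser_def[abs_def] by simp
qed

section \<open>The heat operator applied to the series\<close>

lemma pdt_ser: "t > 0 \<Longrightarrow> pdt (ser heat_kernel) x t = src x t + ser hk_t x t"
  unfolding pdt_def by (rule DERIV_imp_deriv) (rule has_field_derivative_ser_t)

lemma pdx_ser:
  fixes K K' :: "'a::euclidean_space \<Rightarrow> real \<Rightarrow> real"
  assumes "\<And>x t h. t > 0 \<Longrightarrow> ((\<lambda>h. K (x + h *\<^sub>R i) t) has_field_derivative K' (x + h *\<^sub>R i) t) (at h)"
    and "bounded_for_late K" "bounded_for_late K'" "t > 0"
  shows "pdx (ser K) i x t = ser K' x t"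
  unfolding pdx_def using DERIV_imp_deriv[OF has_field_derivative_ser_x[OF assms, of x 0]] by simp

lemma pdx_ser_heat_kernel:
  "i \<in> Basis \<Longrightarrow> t > 0 \<Longrightarrow> pdx (ser heat_kernel) i x t = ser (hk_x i) x t"
  by (intro pdx_ser has_field_derivative_heat_kernel_x bounded_for_late_heat_kernel bounded_for_late_hk_x)

lemma pdx_pdx_ser_heat_kernel:
  assumes "i \<in> Basis" "j \<in> Basis" "t > 0"
  shows "pdx (pdx (ser heat_kernel) i) j x t = ser (hk_xx i j) x t"
proof -
  have "pdx (pdx (ser heat_kernel) i) j x t = pdx (ser (hk_x i)) j x t"
    unfolding pdx_def[of _ j] by (simp add: pdx_ser_heat_kernel assms)
  also have "\<dots> = ser (hk_xx i j) x t"
    by (intro pdx_ser has_field_derivative_hk_x bounded_for_late_hk_xx bounded_for_late_hk_x assms)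
  finally show ?thesis .
qed

text \<open>Since \<open>sum_hk_xx\<close> applies to each term, the Laplacian cancels the
  \<open>hk_t\<close> part of the time derivative, and only the sources remain.\<close>

lemma heat_operator_ser:
  assumes "t > 0"
  shows "pdt (ser heat_kernel) x t - laplacian (ser heat_kernel) x t = src (x::'a::euclidean_space) t"
proof -
  have "laplacian (ser heat_kernel) x t = (\<Sum>i\<in>Basis. ser (hk_xx i i) x t)"
    unfolding laplacian_def by (intro sum.cong refl pdx_pdx_ser_heat_kernel assms)
  also have "\<dots> = (\<Sum>m. \<Sum>i\<in>Basis. d m * ramped (hk_xx i i) (s m) (r m) x t)"
    unfolding ser_def
    by (intro suminf_sum[symmetric] summable_ramped bounded_for_late_hk_xx assms)
  also have "\<dots> = ser hk_t x t"
    unfolding ser_def by (simp add: ramped_def sum_distrib_left[symmetric] sum_hk_xx)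
  finally show ?thesis using pdt_ser[OF assms, of x] by simp
qed

lemma C21_on_ser:
  "C21_on {0<..<1} (ser heat_kernel :: 'a::euclidean_space \<Rightarrow> _)"
  unfolding C21_on_def
proof (intro conjI allI ballI)
  fix x :: 'a and t :: real assume t: "t \<in> {0<..<1}"
  show "(\<lambda>s. ser heat_kernel x s) differentiable (at t)"
    using has_field_derivative_ser_t[of t x] t by (auto simp: real_differentiable_def)
  fix i :: 'a assume i: "i \<in> Basis"
  show "(\<lambda>h. ser heat_kernel (x + h *\<^sub>R i) t) differentiable (at 0)"
    unfolding real_differentiable_def
    using has_field_derivative_ser_x[OF has_field_derivative_heat_kernel_x bounded_for_late_heat_kernel
        bounded_for_late_hk_x[OF i]] t by fastforce
  fix j :: 'a assume j: "j \<in> Basis"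
  have "(\<lambda>h. pdx (ser heat_kernel) i (x + h *\<^sub>R j) t) = (\<lambda>h. ser (hk_x i) (x + h *\<^sub>R j) t)"
    using t by (simp add: pdx_ser_heat_kernel i)
  then show "(\<lambda>h. pdx (ser heat_kernel) i (x + h *\<^sub>R j) t) differentiable (at 0)"
    unfolding real_differentiable_def
    using has_field_derivative_ser_x[OF has_field_derivative_hk_x bounded_for_late_hk_x[OF i]
        bounded_for_late_hk_xx[OF i j]] t by fastforce
next
  have sub: "UNIV \<times> {0<..<1} \<subseteq> (UNIV \<times> {0<..} :: ('a \<times> real) set)" by auto
  show "continuous_on (UNIV \<times> {0<..<1}) (\<lambda>(x::'a, t). ser heat_kernel x t)"
    by (rule continuous_on_subset[OF continuous_on_ser sub])
      (intro continuous_on_heat_kernel bounded_for_late_heat_kernel)+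
  have "continuous_on (UNIV \<times> {0<..}) (\<lambda>(x::'a, t). src x t + ser hk_t x t)"
    using continuous_on_add[OF continuous_on_src continuous_on_ser[OF continuous_on_hk(1) bounded_for_late_hk_t]]
    by (simp add: case_prod_unfold)
  then have "continuous_on (UNIV \<times> {0<..<1}) (\<lambda>(x::'a, t). src x t + ser hk_t x t)"
    by (rule continuous_on_subset[OF _ sub])
  then show "continuous_on (UNIV \<times> {0<..<1}) (\<lambda>(x::'a, t). pdt (ser heat_kernel) x t)"
    by (rule continuous_on_eq) (auto simp: pdt_ser)
  fix i :: 'a assume i: "i \<in> Basis"
  have "continuous_on (UNIV \<times> {0<..<1}) (\<lambda>(x::'a, t). ser (hk_x i) x t)"
    by (rule continuous_on_subset[OF continuous_on_ser[OF continuous_on_hk(2) bounded_for_late_hk_x[OF i]] sub])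
  then show "continuous_on (UNIV \<times> {0<..<1}) (\<lambda>(x::'a, t). pdx (ser heat_kernel) i x t)"
    by (rule continuous_on_eq) (auto simp: pdx_ser_heat_kernel i)
  fix j :: 'a assume j: "j \<in> Basis"
  have "continuous_on (UNIV \<times> {0<..<1}) (\<lambda>(x::'a, t). ser (hk_xx i j) x t)"
    by (rule continuous_on_subset[OF continuous_on_ser[OF continuous_on_hk(3) bounded_for_late_hk_xx[OF i j]] sub])
  then show "continuous_on (UNIV \<times> {0<..<1}) (\<lambda>(x::'a, t). pdx (pdx (ser heat_kernel) i) j x t)"
    by (rule continuous_on_eq) (auto simp: pdx_pdx_ser_heat_kernel i j)
qed

end

subsection \<open>Integrability\<close>

lemma nn_integral_gaussian_finite:
  "(\<integral>\<^sup>+x. ennreal (exp (- (norm (x::'a::euclidean_space))\<^sup>2)) \<partial>lborel) < \<infinity>"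
proof -
  \<comment> \<open>With standard deviation \<open>1 / sqrt 2\<close> the exponent of the normal
    density is exactly \<open>- y\<^sup>2\<close>.\<close>
  have "exp (- y\<^sup>2) = sqrt pi * normal_density 0 (1 / sqrt 2) y" for y :: real
    by (simp add: normal_density_def power_divide real_sqrt_mult)
  then have "integrable lborel (\<lambda>y::real. exp (- y\<^sup>2))"
    by (simp add: integrable_normal_density)
  then have fin: "(\<integral>\<^sup>+y. ennreal (exp (- y\<^sup>2)) \<partial>(lborel::real measure)) < \<infinity>"
    by (simp add: integrable_iff_bounded)
  have "exp (- (norm x)\<^sup>2) = (\<Prod>b\<in>Basis. exp (- (x \<bullet> b)\<^sup>2))" for x :: 'a
  proof -
    have "(norm x)\<^sup>2 = (\<Sum>b\<in>Basis. (x \<bullet> b)\<^sup>2)"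
      unfolding power2_norm_eq_inner euclidean_inner[of x x] by (simp add: power2_eq_square)
    then show ?thesis by (simp add: exp_sum sum_negf[symmetric])
  qed
  then have "(\<integral>\<^sup>+x. ennreal (exp (- (norm (x::'a))\<^sup>2)) \<partial>lborel) =
      (\<integral>\<^sup>+x. (\<Prod>b\<in>Basis. ennreal (exp (- ((x::'a) \<bullet> b)\<^sup>2))) \<partial>lborel)"
    by (simp add: prod_ennreal)
  also have "\<dots> = (\<Prod>b\<in>(Basis::'a set). \<integral>\<^sup>+y. ennreal (exp (- y\<^sup>2)) \<partial>lborel)"
    by (rule nn_integral_lborel_prod) auto
  also have "\<dots> < \<infinity>"
    using fin by (simp add: power_less_top_ennreal)
  finally show ?thesis .
qed

lemma nn_integral_gaussian_scale:
  assumes "c > 0"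
  shows "(\<integral>\<^sup>+x. ennreal (exp (- (norm (x::'a::euclidean_space))\<^sup>2 / c)) \<partial>lborel) =
    ennreal (c powr (real DIM('a) / 2)) * (\<integral>\<^sup>+x. ennreal (exp (- (norm (x::'a))\<^sup>2)) \<partial>lborel)"
proof -
  have p: "ennreal (sqrt c ^ DIM('a)) = ennreal (c powr (real DIM('a) / 2))"
    using assms by (simp add: powr_half_sqrt[symmetric] powr_powr powr_realpow[symmetric])
  have "(\<integral>\<^sup>+x. ennreal (exp (- (norm (x::'a))\<^sup>2 / c)) \<partial>lborel) =
      (\<integral>\<^sup>+x. ennreal (sqrt c ^ DIM('a)) * ennreal (exp (- (norm (sqrt c *\<^sub>R (x::'a)))\<^sup>2 / c)) \<partial>lborel)"
    using assms
    by (subst lborel_affine[of "sqrt c" 0]) (auto simp: nn_integral_density nn_integral_distr ennreal_power)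
  also have "\<dots> = ennreal (sqrt c ^ DIM('a)) * (\<integral>\<^sup>+x. ennreal (exp (- (norm (x::'a))\<^sup>2)) \<partial>lborel)"
    using assms by (simp add: nn_integral_cmult power_mult_distrib)
  finally show ?thesis by (simp only: p)
qed

text \<open>Up to a shift in time, an envelope for the \<open>l\<close>-th powers of all normalized
  pulses at once, in which the width no longer occurs. The cutoff 3 bounds the age
  \<open>t - s + r\<^sup>2\<close> when \<open>t < 1\<close>, \<open>s \<ge> - r\<^sup>2\<close> and
  \<open>r \<le> 1\<close>.\<close>

definition profile :: "real \<Rightarrow> real \<Rightarrow> 'a::euclidean_space \<times> real \<Rightarrow> real" where
  "profile b l p = indicator {0<..<3} (snd p) *
     (snd p powr (- b / 2) * exp (- (norm (fst p))\<^sup>2 / (4 * snd p))) powr l"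

lemma profile_nonneg: "0 \<le> profile b l p"
  by (simp add: profile_def)

lemma measurable_profile [measurable]:
  "profile b l \<in> borel_measurable (borel :: ('a::euclidean_space \<times> real) measure)"
  unfolding profile_def borel_prod[symmetric] by measurable

text \<open>Integrating the Gaussian in space contributes the power \<open>DIM('a) / 2\<close> of
  \<open>t\<close>, so that \<open>t powr e\<close> is left. The hypothesis on \<open>b * l\<close>
  says that \<open>e > -1\<close>, which is integrability at time 0.\<close>

lemma nn_integral_profile_finite:
  assumes "l > 0" "b * l < real DIM('a) + 2"
  shows "(\<integral>\<^sup>+p. ennreal (profile b l (p :: 'a::euclidean_space \<times> real)) \<partial>lborel) < \<infinity>"
proof -
  define J where "J = (\<integral>\<^sup>+x. ennreal (exp (- (norm (x::'a))\<^sup>2)) \<partial>lborel)"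
  define e where "e = real DIM('a) / 2 - b * l / 2"
  have e: "e > -1" using assms by (simp add: e_def)
  have inner: "(\<integral>\<^sup>+x. ennreal (profile b l (x::'a, t)) \<partial>lborel) \<le>
      ennreal ((4 / l) powr (real DIM('a) / 2)) * J * (ennreal (t powr e) * indicator {0..3} t)" for t
  proof (cases "0 < t \<and> t < 3")
    case True
    have "profile b l (x, t) = t powr (- b * l / 2) * exp (- (norm x)\<^sup>2 / (4 * t / l))" for x :: 'a
      using True by (simp add: profile_def powr_mult powr_powr exp_powr_real)
    then have "(\<integral>\<^sup>+x. ennreal (profile b l (x::'a, t)) \<partial>lborel) =
        ennreal (t powr (- b * l / 2)) * (\<integral>\<^sup>+x. ennreal (exp (- (norm (x::'a))\<^sup>2 / (4 * t / l))) \<partial>lborel)"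
      by (simp add: ennreal_mult nn_integral_cmult)
    also have "\<dots> = ennreal (t powr (- b * l / 2)) * (ennreal ((4 * t / l) powr (real DIM('a) / 2)) * J)"
      using True assms(1) unfolding J_def by (subst nn_integral_gaussian_scale) auto
    also have "\<dots> = ennreal (t powr (- b * l / 2) * (4 * t / l) powr (real DIM('a) / 2)) * J"
      by (simp add: ennreal_mult mult.assoc)
    also have "t powr (- b * l / 2) * (4 * t / l) powr (real DIM('a) / 2) =
        (4 / l) powr (real DIM('a) / 2) * t powr e"
      using True assms(1) powr_mult[of "4/l" t "real DIM('a) / 2"]
      by (simp add: e_def powr_add[symmetric] powr_diff powr_minus_divide)
    finally show ?thesis using True by (simp add: ennreal_mult mult_ac)
  next
    case False
    then show ?thesis by (auto simp: profile_def)
  qed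
  have "(\<integral>\<^sup>+p. ennreal (profile b l (p :: 'a \<times> real)) \<partial>lborel) =
      (\<integral>\<^sup>+t. \<integral>\<^sup>+x. ennreal (profile b l (x::'a, t)) \<partial>lborel \<partial>lborel)"
    by (subst lborel_pair.nn_integral_snd) (auto simp: lborel_prod)
  also have "\<dots> \<le> (\<integral>\<^sup>+t. ennreal ((4 / l) powr (real DIM('a) / 2)) * J * (ennreal (t powr e) * indicator {0..3} t) \<partial>lborel)"
    by (intro nn_integral_mono inner)
  also have "\<dots> = ennreal ((4 / l) powr (real DIM('a) / 2)) * J * (\<integral>\<^sup>+t. ennreal (t powr e) * indicator {0..3} t \<partial>lborel)"
    by (rule nn_integral_cmult) measurable
  also have "(\<integral>\<^sup>+t. ennreal (t powr e) * indicator {0..3} t \<partial>lborel) = ennreal (3 powr (e + 1) / (e + 1))"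
    by (rule nn_integral_has_integral_lebesgue') (use has_integral_powr_from_0[OF e, of 3] in auto)
  also have "ennreal ((4 / l) powr (real DIM('a) / 2)) * J * ennreal (3 powr (e + 1) / (e + 1)) < \<infinity>"
    using nn_integral_gaussian_finite[where 'a='a] unfolding J_def by (simp add: ennreal_mult_less_top)
  finally show ?thesis .
qed

text \<open>Translation invariance of Lebesgue measure gives one bound for pulses with different
  starting times.\<close>

lemma nn_integral_profile_translate:
  "(\<integral>\<^sup>+p. ennreal (profile b l (fst p :: 'a, snd p + c)) \<partial>lborel) =
   (\<integral>\<^sup>+p. ennreal (profile b l (p :: 'a::euclidean_space \<times> real)) \<partial>lborel)"
proof -
  have "(\<integral>\<^sup>+p. ennreal (profile b l (p :: 'a \<times> real)) \<partial>lborel) =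
      (\<integral>\<^sup>+p. ennreal (profile b l (p :: 'a \<times> real)) \<partial>distr lborel borel ((+) (0, c)))"
    by (simp add: lborel_distr_plus)
  also have "\<dots> = (\<integral>\<^sup>+p. ennreal (profile b l ((0, c) + p :: 'a \<times> real)) \<partial>lborel)"
    by (subst nn_integral_distr) auto
  also have "\<dots> = (\<integral>\<^sup>+p. ennreal (profile b l (fst p :: 'a, snd p + c)) \<partial>lborel)"
    by (simp add: plus_prod_def add.commute)
  finally show ?thesis ..
qed

text \<open>A substitute for Minkowski's inequality that also covers \<open>l < 1\<close>: each term satisfies
  \<open>sqrt (e m) * w m \<le> T powr (1 / l)\<close>, where \<open>T\<close> is the sum on the right.\<close>

lemma powr_suminf_le:
  fixes e w :: "nat \<Rightarrow> real"
  assumes e: "\<And>m. e m \<ge> 0" and w: "\<And>m. w m \<ge> 0" and l: "l > 0"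
    and S: "summable (\<lambda>m. sqrt (e m))" "(\<Sum>m. sqrt (e m)) > 0"
  shows "ennreal ((\<Sum>m. e m * w m) powr l) \<le>
    ennreal ((\<Sum>m. sqrt (e m)) powr l) * (\<Sum>m. ennreal ((sqrt (e m) * w m) powr l))"
proof (cases "summable (\<lambda>m. (sqrt (e m) * w m) powr l)")
  case False
  then have "(\<Sum>m. ennreal ((sqrt (e m) * w m) powr l)) = \<infinity>"
    using summable_suminf_not_top[of "\<lambda>m. (sqrt (e m) * w m) powr l", OF powr_ge_zero] unfolding infinity_ennreal_def by blast
  then show ?thesis using S by (simp add: ennreal_mult_top)
next
  case True
  define T where "T = (\<Sum>m. (sqrt (e m) * w m) powr l)"
  have T: "T \<ge> 0" unfolding T_def by (intro suminf_nonneg True) simp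
  have "sqrt (e m) * w m \<le> T powr (1 / l)" for m
  proof -
    have "(sqrt (e m) * w m) powr l \<le> T"
      unfolding T_def using sum_le_suminf[OF True, of "{m}"] by simp
    then have "((sqrt (e m) * w m) powr l) powr (1 / l) \<le> T powr (1 / l)"
      using l by (intro powr_mono2) auto
    then show ?thesis using l e[of m] w[of m] by (simp add: powr_powr)
  qed
  then have le: "e m * w m \<le> sqrt (e m) * T powr (1 / l)" for m
    using mult_left_mono[of "sqrt (e m) * w m" "T powr (1 / l)" "sqrt (e m)"] e[of m]
    by (simp add: mult.assoc[symmetric])
  have sm: "summable (\<lambda>m. sqrt (e m) * T powr (1 / l))" by (intro summable_mult2 S)
  have "summable (\<lambda>m. e m * w m)"
    by (rule summable_comparison_test'[OF sm, of 0]) (use le e w in auto)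
  then have "(\<Sum>m. e m * w m) \<le> (\<Sum>m. sqrt (e m) * T powr (1 / l))" and nn: "(\<Sum>m. e m * w m) \<ge> 0"
    using le e w sm by (auto intro!: suminf_le suminf_nonneg)
  then have "(\<Sum>m. e m * w m) \<le> (\<Sum>m. sqrt (e m)) * T powr (1 / l)"
    using suminf_mult2[OF S(1)] by simp
  then have "(\<Sum>m. e m * w m) powr l \<le> ((\<Sum>m. sqrt (e m)) * T powr (1 / l)) powr l"
    using nn l by (intro powr_mono2) auto
  also have "\<dots> = (\<Sum>m. sqrt (e m)) powr l * T"
    using S(2) T l by (simp add: powr_mult powr_powr)
  finally have "ennreal ((\<Sum>m. e m * w m) powr l) \<le> ennreal ((\<Sum>m. sqrt (e m)) powr l) * ennreal T"
    by (simp add: ennreal_mult[symmetric] T ennreal_leI)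
  also have "ennreal T = (\<Sum>m. ennreal ((sqrt (e m) * w m) powr l))"
    unfolding T_def by (rule suminf_ennreal2[symmetric, OF _ True]) simp
  finally show ?thesis .
qed

text \<open>A running pulse has age \<open>\<tau> > r\<^sup>2\<close>. With n the dimension and
  \<open>b \<le> n\<close>, the normalizing factor \<open>r powr (n - b)\<close> is thus at most
  \<open>\<tau> powr ((n - b) / 2)\<close>, which weakens the singularity
  \<open>\<tau> powr (- n / 2)\<close> of the kernel to \<open>\<tau> powr (- b / 2)\<close>,
  whatever \<open>r\<close> is.\<close>

lemma ramped_le_profile:
  fixes x :: "'a::euclidean_space"
  assumes "0 < b" "b \<le> real DIM('a)" "l > 0" "0 < r" "r \<le> 1" "s \<ge> - r\<^sup>2" "0 < t" "t < 1"
  shows "(r powr (real DIM('a) - b) * ramped heat_kernel s r x t) powr l \<le> profile b l (x, t + (r\<^sup>2 - s))"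
proof (cases "t \<le> s")
  case False
  define \<tau> where "\<tau> = t - s + r\<^sup>2"
  have "r\<^sup>2 \<le> 1" using assms by (simp add: power_le_one)
  then have \<tau>: "r\<^sup>2 < \<tau>" "\<tau> < 3" using False assms unfolding \<tau>_def by linarith+
  then have \<tau>0: "\<tau> > 0" using zero_le_power2[of r] by linarith
  have "r \<le> sqrt \<tau>" using \<tau> assms by (simp add: real_le_rsqrt)
  then have 1: "r powr (real DIM('a) - b) \<le> \<tau> powr ((real DIM('a) - b) / 2)"
    using powr_mono2[of "real DIM('a) - b" r "sqrt \<tau>"] assms \<tau>0
    by (simp add: powr_half_sqrt[symmetric] powr_powr)
  have "\<tau> \<le> 4 * pi * \<tau>" using pi_gt3 \<tau>0 by simp
  then have "(4 * pi * \<tau>) powr (- real DIM('a) / 2) \<le> \<tau> powr (- real DIM('a) / 2)"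
    using \<tau>0 by (intro powr_mono2') auto
  then have "heat_kernel x \<tau> \<le> \<tau> powr (- real DIM('a) / 2) * exp (- (norm x)\<^sup>2 / (4 * \<tau>))"
    using \<tau>0 by (simp add: heat_kernel_def)
  moreover have "ramped heat_kernel s r x t \<le> heat_kernel x \<tau>"
    unfolding ramped_def \<tau>_def using ramp_bounds(2) heat_kernel_nonneg by (intro mult_left_le_one_le ramp_bounds) auto
  ultimately have "ramped heat_kernel s r x t \<le> \<tau> powr (- real DIM('a) / 2) * exp (- (norm x)\<^sup>2 / (4 * \<tau>))"
    by linarith
  with 1 have "r powr (real DIM('a) - b) * ramped heat_kernel s r x t \<le>
      \<tau> powr ((real DIM('a) - b) / 2) * (\<tau> powr (- real DIM('a) / 2) * exp (- (norm x)\<^sup>2 / (4 * \<tau>)))"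
    by (intro mult_mono) (auto simp: ramped_heat_kernel_nonneg)
  also have "\<dots> = \<tau> powr (- b / 2) * exp (- (norm x)\<^sup>2 / (4 * \<tau>))"
    using \<tau>0 by (simp add: mult.assoc[symmetric] powr_add[symmetric] diff_divide_distrib)
  finally have "(r powr (real DIM('a) - b) * ramped heat_kernel s r x t) powr l \<le>
      (\<tau> powr (- b / 2) * exp (- (norm x)\<^sup>2 / (4 * \<tau>))) powr l"
    using assms by (intro powr_mono2) (auto simp: ramped_heat_kernel_nonneg)
  moreover have "t + (r\<^sup>2 - s) = \<tau>" by (simp add: \<tau>_def)
  ultimately show ?thesis using \<tau> \<tau>0 by (simp add: profile_def)
qed (simp add: profile_nonneg)

text \<open>Each amplitude is split in two. The factor \<open>r m powr (real DIM('a) - b)\<close>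
  places the pulse below the envelope; the factor \<open>e m\<close> provides convergence, one
  square root of it going into each of the two sums of \<open>powr_suminf_le\<close>.\<close>

lemma (in ramped_series) nn_integral_ser_powr_finite:
  fixes e :: "nat \<Rightarrow> real"
  assumes "0 < b" "b \<le> real DIM('a::euclidean_space)" "l > 0" "b * l < real DIM('a) + 2"
    and r: "\<And>m. r m \<le> 1" "\<And>m. s m \<ge> - (r m)\<^sup>2"
    and e: "\<And>m. e m \<ge> 0" "\<And>m. d m = e m * r m powr (real DIM('a) - b)"
    and S: "summable (\<lambda>m. sqrt (e m))" "(\<Sum>m. sqrt (e m)) > 0" "summable (\<lambda>m. sqrt (e m) powr l)"
  shows "(\<integral>\<^sup>+p. indicator (UNIV \<times> {0<..<1}) p *
      ennreal (ser heat_kernel (fst p :: 'a) (snd p) powr l) \<partial>lborel) < \<infinity>"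
proof -
  define w where "w = (\<lambda>m (p::'a \<times> real). r m powr (real DIM('a) - b) * ramped heat_kernel (s m) (r m) (fst p) (snd p))"
  define J where "J = (\<integral>\<^sup>+p. ennreal (profile b l (p :: 'a \<times> real)) \<partial>lborel)"
  have w0: "w m p \<ge> 0" for m p by (simp add: w_def ramped_heat_kernel_nonneg)
  have ser: "ser heat_kernel (fst p) (snd p) = (\<Sum>m. e m * w m p)" for p
    by (simp add: ser_def w_def e(2) mult.assoc)
  let ?P = "\<lambda>m (p::'a \<times> real). ennreal (sqrt (e m) powr l) * ennreal (profile b l (fst p, snd p + ((r m)\<^sup>2 - s m)))"
  let ?S = "ennreal ((\<Sum>m. sqrt (e m)) powr l)"
  have "indicator (UNIV \<times> {0<..<1}) p * ennreal (ser heat_kernel (fst p :: 'a) (snd p) powr l)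
      \<le> ?S * (\<Sum>m. ?P m p)" for p
  proof (cases "p \<in> UNIV \<times> {0<..<1}")
    case True
    have "ennreal (ser heat_kernel (fst p) (snd p) powr l) \<le> ?S * (\<Sum>m. ennreal ((sqrt (e m) * w m p) powr l))"
      unfolding ser by (intro powr_suminf_le e w0 S assms)
    also have "\<dots> \<le> ?S * (\<Sum>m. ?P m p)"
    proof (intro mult_left_mono suminf_le)
      fix m
      have "(sqrt (e m) * w m p) powr l = sqrt (e m) powr l * w m p powr l"
        using e w0 by (simp add: powr_mult)
      also have "\<dots> \<le> sqrt (e m) powr l * profile b l (fst p, snd p + ((r m)\<^sup>2 - s m))"
        unfolding w_def using True by (intro mult_left_mono ramped_le_profile assms r_pos r) auto
      finally show "ennreal ((sqrt (e m) * w m p) powr l) \<le> ?P m p"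
        by (simp add: ennreal_mult[symmetric] profile_nonneg ennreal_leI)
    qed auto
    finally show ?thesis using True by simp
  qed simp
  then have "(\<integral>\<^sup>+p. indicator (UNIV \<times> {0<..<1}) p * ennreal (ser heat_kernel (fst p :: 'a) (snd p) powr l) \<partial>lborel)
      \<le> (\<integral>\<^sup>+p. ?S * (\<Sum>m. ?P m p) \<partial>lborel)"
    by (intro nn_integral_mono)
  also have "\<dots> = ?S * (\<Sum>m. ennreal (sqrt (e m) powr l) * J)"
  proof -
    have [measurable]: "(\<lambda>p. ennreal (profile b l (fst p :: 'a, snd p + c))) \<in> borel_measurable lborel" for c
    proof -
      have "(\<lambda>p::'a \<times> real. (fst p, snd p + c)) \<in> borel_measurable borel"
        by (intro borel_measurable_continuous_onI continuous_intros)
      from measurable_compose[OF this measurable_profile] show ?thesis by simp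
    qed
    have P: "(\<integral>\<^sup>+p. ?P m p \<partial>lborel) = ennreal (sqrt (e m) powr l) * J" for m
      unfolding J_def nn_integral_profile_translate[where 'a='a, symmetric, of b l "(r m)\<^sup>2 - s m"]
      by (rule nn_integral_cmult) measurable
    have "(\<integral>\<^sup>+p. (\<Sum>m. ?P m p) \<partial>lborel) = (\<Sum>m. \<integral>\<^sup>+p. ?P m p \<partial>lborel)"
      by (rule nn_integral_suminf) measurable
    also have "\<dots> = (\<Sum>m. ennreal (sqrt (e m) powr l) * J)" by (simp only: P)
    finally have sum: "(\<integral>\<^sup>+p. (\<Sum>m. ?P m p) \<partial>lborel) = (\<Sum>m. ennreal (sqrt (e m) powr l) * J)" .
    have "(\<integral>\<^sup>+p. ?S * (\<Sum>m. ?P m p) \<partial>lborel) = ?S * (\<integral>\<^sup>+p. (\<Sum>m. ?P m p) \<partial>lborel)"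
      by (rule nn_integral_cmult) measurable
    then show ?thesis by (simp only: sum)
  qed
  also have "\<dots> = ?S * (ennreal (\<Sum>m. sqrt (e m) powr l) * J)"
    by (simp only: ennreal_suminf_multc suminf_ennreal2[OF powr_ge_zero S(3)])
  also have "\<dots> < \<infinity>"
    using nn_integral_profile_finite[OF assms(3,4)] unfolding J_def by (simp add: ennreal_mult_less_top)
  finally show ?thesis .
qed

subsection \<open>One concentration step\<close>

text \<open>The value of the heat kernel at the origin and age 4, that is, at age
  \<open>4 * r\<^sup>2\<close> for \<open>r = 1\<close>, the largest age that occurs in the lower
  bounds.\<close>

definition hk_const :: "nat \<Rightarrow> real" where
  "hk_const n = (16 * pi) powr (- real n / 2)"

lemma hk_const_pos: "hk_const n > 0"
  by (simp add: hk_const_def)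

lemma square_powr_half:
  fixes r c y :: real
  assumes "r > 0" "c > 0"
  shows "(c * r\<^sup>2) powr (- y / 2) = c powr (- y / 2) * r powr (- y)"
  using assms by (simp add: powr_mult powr_powr flip: powr_numeral)

text \<open>The upper limit on the age controls the prefactor, the lower limit the
  exponential.\<close>

lemma heat_kernel_ge:
  fixes y :: "'a::euclidean_space"
  assumes "r > 0" "r\<^sup>2 / 2 \<le> \<tau>" "\<tau> \<le> 4 * r\<^sup>2"
  shows "hk_const DIM('a) * r powr (- real DIM('a)) * exp (- (norm y)\<^sup>2 / (2 * r\<^sup>2)) \<le> heat_kernel y \<tau>"
proof -
  have \<tau>: "\<tau> > 0" using assms by (smt (verit) half_gt_zero zero_less_power)
  have "hk_const DIM('a) * r powr (- real DIM('a)) = (16 * pi * r\<^sup>2) powr (- real DIM('a) / 2)"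
    using assms square_powr_half[of r "16 * pi" "real DIM('a)"] by (simp add: hk_const_def)
  also have "\<dots> \<le> (4 * pi * \<tau>) powr (- real DIM('a) / 2)"
    using assms \<tau> by (intro powr_mono2') auto
  finally have 1: "hk_const DIM('a) * r powr (- real DIM('a)) \<le> (4 * pi * \<tau>) powr (- real DIM('a) / 2)" .
  have "(norm y)\<^sup>2 / (4 * \<tau>) \<le> (norm y)\<^sup>2 / (2 * r\<^sup>2)"
    using assms \<tau> by (intro divide_left_mono) auto
  then have "exp (- (norm y)\<^sup>2 / (2 * r\<^sup>2)) \<le> exp (- (norm y)\<^sup>2 / (4 * \<tau>))" by simp
  with 1 show ?thesis unfolding heat_kernel_def using \<tau> by (auto intro!: mult_mono)
qed

text \<open>In this time range the switch is fully on and the age lies between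
  \<open>2 * r\<^sup>2\<close> and \<open>4 * r\<^sup>2\<close>; the powers of \<open>r\<close>
  combine to the height \<open>r powr (- a)\<close>.\<close>

lemma ramped_heat_kernel_ge:
  fixes y :: "'a::euclidean_space"
  assumes "r > 0" "s + r\<^sup>2 \<le> q" "q \<le> s + 3 * r\<^sup>2"
  shows "hk_const DIM('a) * r powr (- a) * exp (- (norm y)\<^sup>2 / (2 * r\<^sup>2)) \<le>
    r powr (real DIM('a) - a) * ramped heat_kernel s r y q"
proof -
  have "hk_const DIM('a) * r powr (- real DIM('a)) * exp (- (norm y)\<^sup>2 / (2 * r\<^sup>2)) \<le> heat_kernel y (q - s + r\<^sup>2)"
    using assms zero_le_power2[of r] by (intro heat_kernel_ge) auto
  then have "r powr (real DIM('a) - a) * (hk_const DIM('a) * r powr (- real DIM('a)) * exp (- (norm y)\<^sup>2 / (2 * r\<^sup>2)))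
      \<le> r powr (real DIM('a) - a) * ramped heat_kernel s r y q"
    using assms by (intro mult_left_mono) (auto simp: ramped_after)
  also have "r powr (real DIM('a) - a) * (hk_const DIM('a) * r powr (- real DIM('a)) * exp (- (norm y)\<^sup>2 / (2 * r\<^sup>2)))
      = hk_const DIM('a) * (r powr (real DIM('a) - a) * r powr (- real DIM('a))) * exp (- (norm y)\<^sup>2 / (2 * r\<^sup>2))"
    by simp
  also have "r powr (real DIM('a) - a) * r powr (- real DIM('a)) = r powr (- a)"
    using assms by (simp flip: powr_add)
  finally show ?thesis .
qed

text \<open>While the source is active the age lies between \<open>r\<^sup>2\<close> and
  \<open>2 * r\<^sup>2\<close>, whence the 8 in the exponent. The factor 2 is the maximum of
  \<open>ramp'\<close>, and the additional \<open>r powr (- 2)\<close> is the speed of the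
  switch.\<close>

lemma source_le:
  fixes x :: "'a::euclidean_space"
  assumes "r > 0"
  shows "r powr (real DIM('a) - a) * source s r x t \<le> 2 * r powr (- a - 2) * exp (- (norm x)\<^sup>2 / (8 * r\<^sup>2))"
proof (cases "s < t \<and> t < s + r\<^sup>2")
  case True
  define \<tau> where "\<tau> = t - s + r\<^sup>2"
  have \<tau>: "r\<^sup>2 \<le> \<tau>" "\<tau> \<le> 2 * r\<^sup>2" "\<tau> > 0" using True assms by (auto simp: \<tau>_def add_pos_pos)
  have "1 * r\<^sup>2 \<le> (4 * pi) * \<tau>" using \<tau> pi_gt3 by (intro mult_mono) auto
  then have "(4 * pi * \<tau>) powr (- real DIM('a) / 2) \<le> (1 * r\<^sup>2) powr (- real DIM('a) / 2)"
    using assms by (intro powr_mono2') auto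
  also have "\<dots> = r powr (- real DIM('a))" using assms by (subst square_powr_half) auto
  finally have 1: "(4 * pi * \<tau>) powr (- real DIM('a) / 2) \<le> r powr (- real DIM('a))" .
  have "(norm x)\<^sup>2 / (8 * r\<^sup>2) \<le> (norm x)\<^sup>2 / (4 * \<tau>)"
    using assms \<tau> by (intro divide_left_mono) auto
  then have "exp (- (norm x)\<^sup>2 / (4 * \<tau>)) \<le> exp (- (norm x)\<^sup>2 / (8 * r\<^sup>2))" by simp
  with 1 have "heat_kernel x \<tau> \<le> r powr (- real DIM('a)) * exp (- (norm x)\<^sup>2 / (8 * r\<^sup>2))"
    unfolding heat_kernel_def using \<tau> by (auto intro!: mult_mono)
  then have "source s r x t \<le> 2 / r\<^sup>2 * (r powr (- real DIM('a)) * exp (- (norm x)\<^sup>2 / (8 * r\<^sup>2)))"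
    unfolding source_def \<tau>_def[symmetric] using ramp'_bounds assms
    by (intro mult_mono divide_right_mono heat_kernel_nonneg) auto
  then have "r powr (real DIM('a) - a) * source s r x t \<le>
      r powr (real DIM('a) - a) * (2 / r\<^sup>2 * (r powr (- real DIM('a)) * exp (- (norm x)\<^sup>2 / (8 * r\<^sup>2))))"
    by (rule mult_left_mono) simp
  also have "\<dots> = 2 * (r powr (real DIM('a) - a) * r powr (- real DIM('a)) * r powr (- 2)) * exp (- (norm x)\<^sup>2 / (8 * r\<^sup>2))"
    using assms by (simp add: powr_minus field_simps)
  also have "r powr (real DIM('a) - a) * r powr (- real DIM('a)) * r powr (- 2) = r powr (- a - 2)"
    using assms by (simp flip: powr_add)
  finally show ?thesis .
next
  case False
  then have "source s r x t = 0" using assms by auto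
  then show ?thesis by simp
qed

text \<open>The integral is restricted to a cylinder of radius \<open>r\<close> around
  \<open>x\<close>, placed in time after the pulse is fully on and at least
  \<open>r\<^sup>2 / 2\<close> before \<open>t\<close>. There the power of the kernel is of order
  \<open>r powr (- \<alpha>)\<close>, that of \<open>u\<close> at least of order
  \<open>r powr (- a * lam)\<close> times a Gaussian, and the volume is of order
  \<open>r powr (real DIM('a) + 2)\<close>.\<close>

lemma nonlocal_term_ge:
  fixes x :: "'a::euclidean_space" and u :: "'a \<Rightarrow> real \<Rightarrow> real"
  assumes "0 < \<alpha>" "0 < lam" "r > 0" "- r\<^sup>2 \<le> s" "s + 2 * r\<^sup>2 \<le> 1"
    and t: "s + 2 * r\<^sup>2 \<le> t" "t \<le> s + 3 * r\<^sup>2"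
    and u: "\<And>y q. 0 < q \<Longrightarrow> q < 1 \<Longrightarrow> r powr (real DIM('a) - a) * ramped heat_kernel s r y q \<le> u y q"
  defines "\<kappa> \<equiv> hk_const DIM('a) * exp (- 1)"
  shows "ennreal (\<kappa> powr (\<alpha> / real DIM('a) + lam) * (unit_ball_vol DIM('a) / 2)
        * r powr (real DIM('a) + 2 - \<alpha> - a * lam) * exp (- (norm x)\<^sup>2 / r\<^sup>2) powr lam)
    \<le> (\<integral>\<^sup>+ p. indicator (UNIV \<times> {0<..<1}) p *
          ennreal (heat_kernel (x - fst p) (t - snd p) powr (\<alpha> / real DIM('a))
                   * u (fst p) (snd p) powr lam) \<partial>lborel)"
proof -
  define E where "E = exp (- (norm x)\<^sup>2 / r\<^sup>2)"
  define A where "A = cball x r \<times> {s + r\<^sup>2<..<s + 3/2 * r\<^sup>2}"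
  define c where "c = (\<kappa> * r powr (- real DIM('a))) powr (\<alpha> / real DIM('a)) * (\<kappa> * r powr (- a) * E) powr lam"
  have \<kappa>: "\<kappa> > 0" by (simp add: \<kappa>_def hk_const_pos)
  have n: "real DIM('a) > 0" by simp
  have r2: "r\<^sup>2 > 0" using assms by simp
  have c0: "c \<ge> 0" by (simp add: c_def)
  have pw: "ennreal c * indicator A p \<le> indicator (UNIV \<times> {0<..<1}) p *
          ennreal (heat_kernel (x - fst p) (t - snd p) powr (\<alpha> / real DIM('a))
                   * u (fst p) (snd p) powr lam)" for p
  proof (cases "p \<in> A")
    case True
    obtain y q where p: "p = (y, q)" by (cases p)
    have y: "norm (x - y) \<le> r" and q: "s + r\<^sup>2 < q" "q < s + 3/2 * r\<^sup>2"
      using True by (auto simp: A_def p dist_norm)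
    have q01: "0 < q" "q < 1" using q assms r2 by linarith+
    have tq: "r\<^sup>2 / 2 \<le> t - q" "t - q \<le> 4 * r\<^sup>2" using q t r2 by linarith+
    have "(norm (x - y))\<^sup>2 \<le> r\<^sup>2" using y by (simp add: power_mono)
    \<comment> \<open>The weaker bound produces the factor \<open>exp (- 1)\<close>, which also
      appears in the estimate of \<open>u\<close> below, so that one \<open>\<kappa>\<close> serves
      for both.\<close>
    then have "(norm (x - y))\<^sup>2 \<le> 2 * r\<^sup>2" using r2 by linarith
    then have "exp (- 1) \<le> exp (- (norm (x - y))\<^sup>2 / (2 * r\<^sup>2))"
      using r2 by (simp add: field_simps)
    then have "\<kappa> * r powr (- real DIM('a)) \<le>
        hk_const DIM('a) * r powr (- real DIM('a)) * exp (- (norm (x - y))\<^sup>2 / (2 * r\<^sup>2))"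
      unfolding \<kappa>_def mult.assoc mult.commute[of "exp (- 1)"]
      using hk_const_pos[of "DIM('a)"] by (intro mult_left_mono) auto
    also have "\<dots> \<le> heat_kernel (x - y) (t - q)"
      by (rule heat_kernel_ge) (use assms tq in auto)
    finally have 1: "(\<kappa> * r powr (- real DIM('a))) powr (\<alpha> / real DIM('a)) \<le> heat_kernel (x - y) (t - q) powr (\<alpha> / real DIM('a))"
      using assms \<kappa> by (intro powr_mono2) auto
    have "norm y \<le> norm x + norm (x - y)" by (metis add.commute norm_minus_commute norm_triangle_sub)
    then have "(norm y)\<^sup>2 \<le> (norm x + r)\<^sup>2" using y by (intro power_mono) auto
    \<comment> \<open>Passing from \<open>y\<close> to \<open>x\<close> doubles the exponent;
      therefore \<open>E\<close> has the denominator \<open>r\<^sup>2\<close> where the pulse has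
      \<open>2 * r\<^sup>2\<close>.\<close>
    also have "\<dots> \<le> 2 * (norm x)\<^sup>2 + 2 * r\<^sup>2"
      using sum_squares_bound[of "norm x" r] by (simp add: power2_sum)
    finally have "(norm y)\<^sup>2 / (2 * r\<^sup>2) \<le> (norm x)\<^sup>2 / r\<^sup>2 + 1"
      using r2 by (simp add: field_simps)
    then have "exp (- 1) * E \<le> exp (- (norm y)\<^sup>2 / (2 * r\<^sup>2))"
      unfolding E_def exp_add[symmetric] by simp
    then have "\<kappa> * r powr (- a) * E \<le> hk_const DIM('a) * r powr (- a) * exp (- (norm y)\<^sup>2 / (2 * r\<^sup>2))"
      unfolding \<kappa>_def mult.assoc mult.left_commute[of "exp (- 1)"]
      using hk_const_pos[of "DIM('a)"] by (intro mult_left_mono) auto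
    also have "\<dots> \<le> r powr (real DIM('a) - a) * ramped heat_kernel s r y q"
      using assms(3) q r2 by (intro ramped_heat_kernel_ge) auto
    also have "\<dots> \<le> u y q" using u q01 by simp
    finally have 2: "(\<kappa> * r powr (- a) * E) powr lam \<le> u y q powr lam"
      using assms \<kappa> by (intro powr_mono2) (auto simp: E_def)
    have "c \<le> heat_kernel (x - y) (t - q) powr (\<alpha> / real DIM('a)) * u y q powr lam"
      unfolding c_def by (intro mult_mono 1 2) auto
    then show ?thesis using True q01 by (simp add: p ennreal_leI)
  qed simp
  have "r ^ DIM('a) * r\<^sup>2 = r powr (real DIM('a) + 2)"
    using assms by (simp add: powr_add powr_realpow)
  moreover have "c = \<kappa> powr (\<alpha> / real DIM('a) + lam) * r powr (- \<alpha> - a * lam) * E powr lam"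
  proof -
    have "(\<kappa> * r powr (- real DIM('a))) powr (\<alpha> / real DIM('a)) = \<kappa> powr (\<alpha> / real DIM('a)) * r powr (- \<alpha>)"
      using \<kappa> n by (simp add: powr_mult powr_powr)
    moreover have "(\<kappa> * r powr (- a) * E) powr lam = \<kappa> powr lam * r powr (- a * lam) * E powr lam"
      using \<kappa> by (simp add: powr_mult powr_powr E_def)
    moreover have "r powr (- \<alpha> - a * lam) = r powr (- \<alpha>) * r powr (- a * lam)"
      unfolding powr_add[symmetric] by simp
    ultimately show ?thesis unfolding c_def by (simp add: powr_add mult_ac)
  qed
  ultimately have "c * (unit_ball_vol DIM('a) * r ^ DIM('a) * (r\<^sup>2 / 2)) =
      \<kappa> powr (\<alpha> / real DIM('a) + lam) * (unit_ball_vol DIM('a) / 2)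
        * (r powr (real DIM('a) + 2) * r powr (- \<alpha> - a * lam)) * E powr lam"
    by (simp add: mult_ac)
  also have "r powr (real DIM('a) + 2) * r powr (- \<alpha> - a * lam) = r powr (real DIM('a) + 2 - \<alpha> - a * lam)"
    unfolding powr_add[symmetric] by (simp add: algebra_simps)
  finally have eq: "c * (unit_ball_vol DIM('a) * r ^ DIM('a) * (r\<^sup>2 / 2)) =
      \<kappa> powr (\<alpha> / real DIM('a) + lam) * (unit_ball_vol DIM('a) / 2)
        * r powr (real DIM('a) + 2 - \<alpha> - a * lam) * E powr lam" .
  have "emeasure lborel A = emeasure lborel (cball x r) * emeasure lborel {s + r\<^sup>2<..<s + 3/2 * r\<^sup>2}"
    unfolding A_def lborel_prod[symmetric] by (rule lborel.emeasure_pair_measure_Times) auto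
  also have "emeasure lborel (cball x r) = ennreal (unit_ball_vol DIM('a) * r ^ DIM('a))"
    using assms by (intro emeasure_cball) auto
  also have "emeasure lborel {s + r\<^sup>2<..<s + 3/2 * r\<^sup>2} = ennreal (r\<^sup>2 / 2)"
    using r2 by simp
  also have "ennreal (unit_ball_vol DIM('a) * r ^ DIM('a)) * ennreal (r\<^sup>2 / 2) =
      ennreal (unit_ball_vol DIM('a) * r ^ DIM('a) * (r\<^sup>2 / 2))"
    using assms by (intro ennreal_mult[symmetric]) auto
  finally have "ennreal c * emeasure lborel A = ennreal (c * (unit_ball_vol DIM('a) * r ^ DIM('a) * (r\<^sup>2 / 2)))"
    using c0 assms by (simp only:) (intro ennreal_mult[symmetric], auto)
  moreover have "A \<in> sets lborel"
    unfolding A_def by (simp add: borel_Times)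
  ultimately have "(\<integral>\<^sup>+ p. ennreal c * indicator A p \<partial>lborel) =
      ennreal (c * (unit_ball_vol DIM('a) * r ^ DIM('a) * (r\<^sup>2 / 2)))"
    by (simp add: nn_integral_cmult_indicator)
  then show ?thesis
    using nn_integral_mono[OF pw, of lborel "\<lambda>p. p"] unfolding eq E_def by simp
qed

text \<open>A pulse pays for the source of its successor, of width \<open>r / L\<close> and start
  \<open>s + 2 * r\<^sup>2\<close>: both factors on the right are bounded below by the old pulse
  alone. The quotient of the powers of \<open>r\<close> is the left side of \<open>small\<close>,
  and the Gaussian tails compare because the source is \<open>L\<close> times narrower.\<close>

lemma step_inequality:
  fixes x :: "'a::euclidean_space" and u :: "'a \<Rightarrow> real \<Rightarrow> real"
  assumes "0 < \<alpha>" "0 < lam" "0 < \<sigma>" "r > 0" "- r\<^sup>2 \<le> s" "s + 2 * r\<^sup>2 \<le> 1"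
    and L: "1 \<le> L" "8 * (lam + \<sigma>) \<le> L\<^sup>2"
    and t: "s + 2 * r\<^sup>2 < t" "t < s + 2 * r\<^sup>2 + (r / L)\<^sup>2" "t < 1"
    and u: "\<And>y q. 0 < q \<Longrightarrow> q < 1 \<Longrightarrow> r powr (real DIM('a) - a) * ramped heat_kernel s r y q \<le> u y q"
    and small: "r powr (a * (lam + \<sigma> - 1) - (real DIM('a) + 4 - \<alpha>)) \<le>
      (hk_const DIM('a) * exp (- 1)) powr (\<alpha> / real DIM('a) + lam + \<sigma>) * unit_ball_vol DIM('a) / (4 * L powr (a + 2))"
  shows "ennreal ((r / L) powr (real DIM('a) - a) * source (s + 2 * r\<^sup>2) (r / L) x t)
    \<le> (\<integral>\<^sup>+ p. indicator (UNIV \<times> {0<..<1}) p *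
          ennreal (heat_kernel (x - fst p) (t - snd p) powr (\<alpha> / real DIM('a))
                   * u (fst p) (snd p) powr lam) \<partial>lborel) * ennreal (u x t powr \<sigma>)"
proof -
  define \<kappa> where "\<kappa> = hk_const DIM('a) * exp (- 1)"
  define E where "E = exp (- (norm x)\<^sup>2 / r\<^sup>2)"
  have \<kappa>: "\<kappa> > 0" by (simp add: \<kappa>_def hk_const_pos)
  have E: "E > 0" by (simp add: E_def)
  have r2: "r\<^sup>2 > 0" using assms by simp
  have L0: "L > 0" using L by simp
  have "(r / L)\<^sup>2 \<le> r\<^sup>2" using L r2 assms by (intro power_mono) (auto simp: field_simps)
  \<comment> \<open>The successor is switched on before \<open>s + 3 * r\<^sup>2\<close>, the limit
    up to which the lower bounds for the old pulse are valid.\<close>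
  then have t3: "t \<le> s + 3 * r\<^sup>2" using t by linarith
  have t0: "t > 0" using t assms r2 by linarith
  let ?\<delta> = "a * (lam + \<sigma> - 1) - (real DIM('a) + 4 - \<alpha>)"
  let ?V = "unit_ball_vol DIM('a)"
  let ?I = "\<integral>\<^sup>+ p. indicator (UNIV \<times> {0<..<1}) p *
          ennreal (heat_kernel (x - fst p) (t - snd p) powr (\<alpha> / real DIM('a))
                   * u (fst p) (snd p) powr lam) \<partial>lborel"
  let ?B = "\<kappa> powr (\<alpha> / real DIM('a) + lam) * (?V / 2) * r powr (real DIM('a) + 2 - \<alpha> - a * lam) * E powr lam"
  have I: "ennreal ?B \<le> ?I"
    unfolding \<kappa>_def E_def by (rule nonlocal_term_ge) (use assms t3 in auto)
  have "(norm x)\<^sup>2 / (2 * r\<^sup>2) \<le> (norm x)\<^sup>2 / r\<^sup>2"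
    using r2 by (intro divide_left_mono) auto
  then have "E \<le> exp (- (norm x)\<^sup>2 / (2 * r\<^sup>2))" by (simp add: E_def)
  moreover have "\<kappa> \<le> hk_const DIM('a)" using hk_const_pos[of "DIM('a)"] by (simp add: \<kappa>_def)
  ultimately have "\<kappa> * r powr (- a) * E \<le> hk_const DIM('a) * r powr (- a) * exp (- (norm x)\<^sup>2 / (2 * r\<^sup>2))"
    using \<kappa> E hk_const_pos[of "DIM('a)"] by (intro mult_mono) auto
  also have "\<dots> \<le> r powr (real DIM('a) - a) * ramped heat_kernel s r x t"
    using assms(4) t r2 t3 by (intro ramped_heat_kernel_ge) auto
  also have "\<dots> \<le> u x t" using u t0 t by simp
  finally have U: "(\<kappa> * r powr (- a) * E) powr \<sigma> \<le> u x t powr \<sigma>"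
    using assms \<kappa> E by (intro powr_mono2) auto
  have "(r / L) powr (real DIM('a) - a) * source (s + 2 * r\<^sup>2) (r / L) x t
      \<le> 2 * (r / L) powr (- a - 2) * exp (- (norm x)\<^sup>2 / (8 * (r / L)\<^sup>2))"
    using assms L0 by (intro source_le) auto
  also have "\<dots> \<le> 2 * (r / L) powr (- a - 2) * E powr (lam + \<sigma>)"
  proof -
    \<comment> \<open>Comparison of the tails: the source decays with exponent
      \<open>L\<^sup>2 * (norm x)\<^sup>2 / (8 * r\<^sup>2)\<close>, the right-hand side with
      \<open>(lam + \<sigma>) * (norm x)\<^sup>2 / r\<^sup>2\<close>.\<close>
    have "8 * ((lam + \<sigma>) * (norm x)\<^sup>2) \<le> L\<^sup>2 * (norm x)\<^sup>2"
      unfolding mult.assoc[symmetric] using L by (intro mult_right_mono) auto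
    then have "(8 * ((lam + \<sigma>) * (norm x)\<^sup>2)) / (8 * r\<^sup>2) \<le> L\<^sup>2 * (norm x)\<^sup>2 / (8 * r\<^sup>2)"
      by (rule divide_right_mono) simp
    then have "(lam + \<sigma>) * ((norm x)\<^sup>2 / r\<^sup>2) \<le> (norm x)\<^sup>2 / (8 * (r / L)\<^sup>2)"
      unfolding mult_divide_mult_cancel_left_if using L0 by (simp add: power_divide mult.commute)
    then show ?thesis by (simp add: E_def exp_powr_real mult_left_mono mult.commute)
  qed
  also have "(r / L) powr (- a - 2) = L powr (a + 2) * r powr (- a - 2)"
    using powr_divide[of r L "- a - 2"] powr_minus[of L "a + 2"] \<open>r > 0\<close> L0 by (simp add: divide_inverse)
  also have "2 * (L powr (a + 2) * r powr (- a - 2)) * E powr (lam + \<sigma>) \<le> ?B * (\<kappa> * r powr (- a) * E) powr \<sigma>"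
  proof -
    have "4 * L powr (a + 2) * r powr ?\<delta> \<le> \<kappa> powr (\<alpha> / real DIM('a) + lam + \<sigma>) * ?V"
      using small L0 unfolding \<kappa>_def by (simp add: field_simps)
    \<comment> \<open>The multiplier carries the powers of \<open>r\<close> and \<open>E\<close> of
      the right-hand side; its exponent of \<open>r\<close> and \<open>?\<delta>\<close> add up to
      \<open>- a - 2\<close>, the order of the source.\<close>
    then have "4 * L powr (a + 2) * r powr ?\<delta> * (r powr (real DIM('a) + 2 - \<alpha> - a * lam - a * \<sigma>) * E powr (lam + \<sigma>) / 2)
       \<le> \<kappa> powr (\<alpha> / real DIM('a) + lam + \<sigma>) * ?V * (r powr (real DIM('a) + 2 - \<alpha> - a * lam - a * \<sigma>) * E powr (lam + \<sigma>) / 2)"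
      by (rule mult_right_mono) simp
    also have "\<dots> = ?B * (\<kappa> * r powr (- a) * E) powr \<sigma>"
    proof -
      have "\<kappa> powr (\<alpha> / real DIM('a) + lam + \<sigma>) = \<kappa> powr (\<alpha> / real DIM('a) + lam) * \<kappa> powr \<sigma>"
        by (rule powr_add)
      moreover have "r powr (real DIM('a) + 2 - \<alpha> - a * lam - a * \<sigma>) = r powr (real DIM('a) + 2 - \<alpha> - a * lam) * r powr (- a * \<sigma>)"
        using assms by (simp flip: powr_add)
      moreover have "(\<kappa> * r powr (- a) * E) powr \<sigma> = \<kappa> powr \<sigma> * r powr (- a * \<sigma>) * E powr \<sigma>"
        using \<kappa> E by (simp add: powr_mult powr_powr)
      moreover have "E powr (lam + \<sigma>) = E powr lam * E powr \<sigma>" by (rule powr_add)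
      ultimately show ?thesis by (simp add: mult_ac)
    qed
    also have "4 * L powr (a + 2) * r powr ?\<delta> * (r powr (real DIM('a) + 2 - \<alpha> - a * lam - a * \<sigma>) * E powr (lam + \<sigma>) / 2)
       = 2 * (L powr (a + 2) * (r powr ?\<delta> * r powr (real DIM('a) + 2 - \<alpha> - a * lam - a * \<sigma>))) * E powr (lam + \<sigma>)"
      by simp
    also have "r powr ?\<delta> * r powr (real DIM('a) + 2 - \<alpha> - a * lam - a * \<sigma>) = r powr (- a - 2)"
      unfolding powr_add[symmetric] by (simp add: algebra_simps)
    finally show ?thesis .
  qed
  finally have "(r / L) powr (real DIM('a) - a) * source (s + 2 * r\<^sup>2) (r / L) x t \<le> ?B * u x t powr \<sigma>"
    using U by (smt (verit, best) E \<kappa> mult_left_mono mult_nonneg_nonneg powr_ge_zero unit_ball_vol_nonneg divide_nonneg_nonneg of_nat_0_le_iff)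
  then have "ennreal ((r / L) powr (real DIM('a) - a) * source (s + 2 * r\<^sup>2) (r / L) x t) \<le> ennreal ?B * ennreal (u x t powr \<sigma>)"
    by (simp add: ennreal_mult[symmetric] ennreal_leI)
  also have "\<dots> \<le> ?I * ennreal (u x t powr \<sigma>)"
    by (rule mult_right_mono[OF I]) simp
  finally show ?thesis .
qed

subsection \<open>The arrangement of the pulses\<close>

lemma summable_prod_decode:
  fixes A B :: real
  assumes "0 \<le> A" "A < 1" "0 \<le> B" "B < 1"
  shows "summable (\<lambda>m. A ^ fst (prod_decode m) * B ^ snd (prod_decode m))"
proof -
  have geo: "((\<lambda>k. C ^ k) has_sum (1 / (1 - C))) UNIV" if "0 \<le> C" "C < 1" for C :: real
    using geometric_sums[of C] that by (intro norm_summable_imp_has_sum) (auto intro!: summable_geometric)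
  have "(\<lambda>(j, k). A ^ j * B ^ k) summable_on Sigma UNIV (\<lambda>_. UNIV)"
  proof (rule summable_on_SigmaI)
    fix j :: nat
    show "((\<lambda>k. case (j, k) of (j, k) \<Rightarrow> A ^ j * B ^ k) has_sum (A ^ j * (1 / (1 - B)))) UNIV"
      using has_sum_cmult_right[OF geo[OF assms(3,4)], of "A ^ j"] by simp
  next
    show "(\<lambda>j. A ^ j * (1 / (1 - B))) summable_on UNIV"
      using has_sum_imp_summable[OF geo[OF assms(1,2)]] by (rule summable_on_cmult_left)
  qed (use assms in auto)
  then have "(\<lambda>m. case prod_decode m of (j, k) \<Rightarrow> A ^ j * B ^ k) summable_on UNIV"
    using summable_on_reindex_bij_betw[OF bij_prod_decode, of "\<lambda>(j, k). A ^ j * B ^ k"] by simp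
  then show ?thesis
    by (intro summable_on_imp_summable) (simp add: case_prod_unfold)
qed

text \<open>\<open>R\<close> is the largest width, \<open>L\<close> the ratio of successive widths
  in a chain, and \<open>N j\<close> the index of the last pulse of chain \<open>j\<close>. The
  bound on \<open>R\<close> keeps all switching before time 1; \<open>L \<ge> 2\<close> makes the
  duration of a chain comparable to the square of its first width.\<close>

locale blocks =
  fixes R L :: real and N :: "nat \<Rightarrow> nat"
  assumes R: "0 < R" "R \<le> 1/2" and L: "2 \<le> L"
begin

definition rad :: "nat \<Rightarrow> nat \<Rightarrow> real" where
  "rad j k = R / 2 ^ j / L ^ k"

text \<open>The negative first value makes the first pulse of each chain a caloric function for all \<open>t > 0\<close>;
  each further pulse starts only after its predecessor has been fully on for a time \<open>(rad j k)\<^sup>2\<close>.\<close>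

fun start :: "nat \<Rightarrow> nat \<Rightarrow> real" where
  "start j 0 = - (rad j 0)\<^sup>2"
| "start j (Suc k) = start j k + 2 * (rad j k)\<^sup>2"

lemma rad_pos: "rad j k > 0"
  using R L by (simp add: rad_def)

lemma rad_Suc: "rad j (Suc k) = rad j k / L"
  by (simp add: rad_def)

lemma rad_le_0: "rad j k \<le> rad j 0"
  using R L one_le_power[of L k] by (simp add: rad_def field_simps)

lemma rad_le_R: "rad j k \<le> R"
proof -
  have "rad j 0 \<le> R" using R one_le_power[of "2::real" j] by (simp add: rad_def field_simps)
  then show ?thesis using rad_le_0[of j k] by linarith
qed

lemma rad_powr: "rad j k powr q = R powr q * (2 powr (- q)) ^ j * (L powr (- q)) ^ k"
proof -
  have p: "(x ^ i) powr q = (x powr q) ^ i" if "x > 0" for x :: real and i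
    using that by (simp add: powr_powr mult.commute flip: powr_realpow)
  have "rad j k powr q = R powr q / (2 powr q) ^ j / (L powr q) ^ k"
    using R L by (simp add: rad_def powr_divide powr_mult p)
  then show ?thesis by (simp add: powr_minus power_inverse divide_inverse)
qed

lemma summable_rad_powr:
  assumes "q > 0"
  shows "summable (\<lambda>m. rad (fst (prod_decode m)) (snd (prod_decode m)) powr q)"
proof -
  have "2 powr (- q) < (1::real)" "L powr (- q) < 1"
    using assms L by (auto intro!: powr_less_one)
  then have "summable (\<lambda>m. R powr q * ((2 powr (- q)) ^ fst (prod_decode m) * (L powr (- q)) ^ snd (prod_decode m)))"
    by (intro summable_mult summable_prod_decode) auto
  then show ?thesis by (simp add: rad_powr mult.assoc)
qed

lemma start_mono: "k \<le> k' \<Longrightarrow> start j k \<le> start j k'"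
  by (rule lift_Suc_mono_le[of "start j"]) simp

lemma start_ge: "- (rad j k)\<^sup>2 \<le> start j k"
proof (cases k)
  case (Suc i)
  have "start j 1 \<le> start j k" using Suc by (intro start_mono) simp
  then have "(rad j 0)\<^sup>2 \<le> start j k" by simp
  then have "0 \<le> start j k" using zero_le_power2[of "rad j 0"] by (rule order.trans[rotated])
  then show ?thesis using zero_le_power2[of "rad j k"] by linarith
qed simp

lemma start_pos: "k > 0 \<Longrightarrow> (rad j 0)\<^sup>2 \<le> start j k"
  using start_mono[of 1 k j] by simp

text \<open>Since \<open>L \<ge> 2\<close>, three times the square of a width is at most the square
  of the preceding one, so the left side does not increase with \<open>k\<close>; at
  \<open>k = 0\<close> there is equality. A chain thus ends in time however long it is.\<close>

lemma start_le: "start j k + 3 * (rad j k)\<^sup>2 \<le> 2 * (rad j 0)\<^sup>2"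
proof (induction k)
  case (Suc k)
  have "4 \<le> L\<^sup>2" using L power_mono[of 2 L 2] by simp
  then have "4 * (rad j (Suc k))\<^sup>2 \<le> L\<^sup>2 * (rad j (Suc k))\<^sup>2" by (intro mult_right_mono) auto
  also have "\<dots> = (rad j k)\<^sup>2" using L by (simp add: rad_Suc power_divide)
  finally have "3 * (rad j (Suc k))\<^sup>2 \<le> (rad j k)\<^sup>2" using zero_le_power2[of "rad j (Suc k)"] by linarith
  then show ?case using Suc by simp
qed simp

text \<open>First pulses are switched on before time 0, the others of chain \<open>j\<close> between
  \<open>(rad j 0)\<^sup>2\<close> and \<open>2 * (rad j 0)\<^sup>2\<close>. These windows do not
  meet for different \<open>j\<close>, because the first width is halved from chain to chain, and
  within a chain a pulse starts only after its predecessor is on.\<close>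

lemma block_times_disjoint:
  assumes "start j k < t" "t < start j k + (rad j k)\<^sup>2" "start j' k' < t" "t < start j' k' + (rad j' k')\<^sup>2" "t > 0"
  shows "j = j' \<and> k = k'"
proof -
  have j: "\<not> j < j'" if "start j k < t" "t < start j k + (rad j k)\<^sup>2" "start j' k' < t" "t < start j' k' + (rad j' k')\<^sup>2" for j k j' k'
  proof
    assume "j < j'"
    have "k > 0" using that(2) assms(5) by (cases k) auto
    then have "(rad j 0)\<^sup>2 < t" using start_pos[of k j] that by linarith
    moreover have "t < 2 * (rad j' 0)\<^sup>2"
      using start_le[of j' k'] that zero_le_power2[of "rad j' k'"] by linarith
    moreover have "4 * (rad j' 0)\<^sup>2 \<le> (rad j 0)\<^sup>2"
    proof -
      have "2 * 2 ^ j \<le> (2::real) ^ j'"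
        using \<open>j < j'\<close> power_increasing[of "Suc j" j' "2::real"] by simp
      then have "2 * rad j' 0 \<le> rad j 0" using R by (simp add: rad_def field_simps)
      then have "(2 * rad j' 0)\<^sup>2 \<le> (rad j 0)\<^sup>2" using rad_pos[of j' 0] by (intro power_mono) auto
      then show ?thesis by (simp add: power_mult_distrib)
    qed
    ultimately show False using zero_le_power2[of "rad j' 0"] by linarith
  qed
  have k: "\<not> k < k'" if "start j k < t" "t < start j k + (rad j k)\<^sup>2" "start j k' < t" for j k k'
  proof
    assume "k < k'"
    then have "start j (Suc k) \<le> start j k'" by (intro start_mono) simp
    then show False using that zero_le_power2[of "rad j k"] by simp
  qed
  have "j = j'" using j[OF assms(1-4)] j[OF assms(3,4,1,2)] by simp
  then show ?thesis using k[of j k k'] k[of j k' k] assms by (meson linorder_neqE_nat)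
qed

section \<open>Enumeration of the pulses and their amplitudes\<close>

definition row :: "nat \<Rightarrow> nat" where "row m = fst (prod_decode m)"
definition col :: "nat \<Rightarrow> nat" where "col m = snd (prod_decode m)"

lemma row_col_encode [simp]: "row (prod_encode (j, k)) = j" "col (prod_encode (j, k)) = k"
  by (simp_all add: row_def col_def)

lemma row_col_inj: "row m = row m' \<Longrightarrow> col m = col m' \<Longrightarrow> m = m'"
  unfolding row_def col_def by (metis prod.expand prod_decode_inverse)

text \<open>The exponent is a parameter because the square roots and powers of amplitudes that
  integrability calls for are again of this form.\<close>

definition coeff_of :: "real \<Rightarrow> nat \<Rightarrow> real" where
  "coeff_of q m = (if col m \<le> N (row m) then rad (row m) (col m) powr q else 0)"

lemma coeff_of_nonneg: "0 \<le> coeff_of q m"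
  by (simp add: coeff_of_def)

lemma summable_coeff_of: "q > 0 \<Longrightarrow> summable (coeff_of q)"
  by (rule summable_comparison_test'[OF summable_rad_powr, of q 0])
    (auto simp: coeff_of_def row_def col_def)

text \<open>By \<open>start_le\<close>, a chain with large \<open>j\<close> lies entirely before
  \<open>\<tau>\<close>. The finitely many other chains contribute finitely many pulses, as each is
  cut off at \<open>N j\<close>.\<close>

lemma eventually_late:
  assumes "\<tau> > 0"
  shows "\<forall>\<^sub>F m in sequentially. coeff_of q m = 0 \<or> start (row m) (col m) + (rad (row m) (col m))\<^sup>2 \<le> \<tau>"
proof -
  have "(\<lambda>j. 2 * (R * (1/2) ^ j)\<^sup>2) \<longlonglongrightarrow> 2 * (R * 0)\<^sup>2"
    by (intro tendsto_intros LIMSEQ_realpow_zero) auto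
  then have "\<forall>\<^sub>F j in sequentially. 2 * (R * (1/2) ^ j)\<^sup>2 < \<tau>"
    using assms by (intro order_tendstoD(2)) auto
  moreover have "R * (1/2) ^ j = rad j 0" for j
    by (simp add: rad_def power_one_over)
  ultimately obtain J where J: "2 * (rad j 0)\<^sup>2 < \<tau>" if "j \<ge> J" for j
    unfolding eventually_sequentially by metis
  have "finite (prod_encode ` (SIGMA j:{..<J}. {..N j}))" by (intro finite_imageI finite_SigmaI) auto
  moreover have "{m. \<not> (coeff_of q m = 0 \<or> start (row m) (col m) + (rad (row m) (col m))\<^sup>2 \<le> \<tau>)}
      \<subseteq> prod_encode ` (SIGMA j:{..<J}. {..N j})"
  proof
    fix m assume "m \<in> {m. \<not> (coeff_of q m = 0 \<or> start (row m) (col m) + (rad (row m) (col m))\<^sup>2 \<le> \<tau>)}"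
    then have m: "col m \<le> N (row m)" "start (row m) (col m) + (rad (row m) (col m))\<^sup>2 > \<tau>"
      by (auto simp: coeff_of_def split: if_splits)
    have "row m < J"
    proof (rule ccontr)
      assume "\<not> row m < J"
      then show False
        using J[of "row m"] m(2) start_le[of "row m" "col m"] zero_le_power2[of "rad (row m) (col m)"] by simp
    qed
    then have "(row m, col m) \<in> (SIGMA j:{..<J}. {..N j})" using m by simp
    moreover have "m = prod_encode (row m, col m)" by (simp add: row_def col_def)
    ultimately show "m \<in> prod_encode ` (SIGMA j:{..<J}. {..N j})" by blast
  qed
  ultimately have "finite {m. \<not> (coeff_of q m = 0 \<or> start (row m) (col m) + (rad (row m) (col m))\<^sup>2 \<le> \<tau>)}"
    by (rule rev_finite_subset)
  then show ?thesis by (simp only: cofinite_eq_sequentially[symmetric] eventually_cofinite)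
qed

lemma ramped_series_blocks:
  assumes "q > 0"
  shows "ramped_series (coeff_of q) (\<lambda>m. start (row m) (col m)) (\<lambda>m. rad (row m) (col m))"
  using assms by unfold_locales (simp_all add: coeff_of_nonneg summable_coeff_of rad_pos eventually_late)

end

subsection \<open>The solution\<close>

text \<open>The conditions \<open>a < n\<close> and \<open>a * lam < n + 2\<close> together read
  \<open>a < P\<close>, and the branches of \<open>G_alpha\<close> correspond to the two possible
  values of the minimum \<open>P\<close>. In both, the hypothesis on \<open>\<sigma>\<close> yields
  the last inequality with \<open>P\<close> in place of \<open>a\<close>, which leaves room below
  \<open>P\<close> for \<open>a\<close> and then for \<open>b\<close>.\<close>

lemma exists_exponents:
  fixes \<alpha> lam \<sigma> :: real
  assumes "n > 0" "0 < \<alpha>" "\<alpha> < real n + 2" "lam > 0" "\<sigma> > G_alpha n \<alpha> lam"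
  shows "\<sigma> > 0"
    and "\<exists>a b. 0 < a \<and> a < b \<and> b < real n \<and> b * lam < real n + 2 \<and> a * (lam + \<sigma> - 1) > real n + 4 - \<alpha>"
proof -
  define P where "P = min (real n) ((real n + 2) / lam)"
  have n: "real n > 0" using assms by simp
  have P: "P > 0" using n assms by (simp add: P_def)
  have "\<sigma> > 0 \<and> P * (lam + \<sigma> - 1) > real n + 4 - \<alpha>"
  proof (cases "lam < (real n + 2) / real n")
    case True
    then have nl: "lam * real n < real n + 2" using n by (simp add: field_simps)
    then have "P = real n" using n assms by (simp add: P_def min_def field_simps)
    moreover have s: "\<sigma> * real n > 2 * (real n + 2) - \<alpha> - lam * real n"
      using assms True n by (simp add: G_alpha_def field_simps)
    moreover have "\<sigma> > 0"
    proof -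
      have "2 * (real n + 2) - \<alpha> - lam * real n > 0" using nl assms(3) by argo
      then have "\<sigma> * real n > 0" using s by (rule less_trans)
      then show ?thesis using n by (simp add: zero_less_mult_iff)
    qed
    ultimately show ?thesis by (simp add: algebra_simps)
  next
    case False
    then have "lam * real n \<ge> real n + 2" using n by (simp add: field_simps)
    then have P: "P = (real n + 2) / lam" using n assms by (simp add: P_def min_def field_simps)
    have s: "\<sigma> > 0" "\<sigma> > 1 - (\<alpha> - 2) / (real n + 2) * lam"
      using assms False by (auto simp: G_alpha_def)
    have "P * \<sigma> > P * (1 - (\<alpha> - 2) / (real n + 2) * lam)"
      using s(2) \<open>P > 0\<close> by (rule mult_strict_left_mono)
    also have "P * (1 - (\<alpha> - 2) / (real n + 2) * lam) = P - (\<alpha> - 2)"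
    proof -
      have "P * ((\<alpha> - 2) / (real n + 2) * lam) = \<alpha> - 2" using assms(4) n by (simp add: P)
      then show ?thesis by (simp add: right_diff_distrib)
    qed
    finally have "P * \<sigma> > P - (\<alpha> - 2)" .
    moreover have "P * lam = real n + 2" using assms by (simp add: P)
    ultimately show ?thesis using s by (simp add: algebra_simps)
  qed
  then show "\<sigma> > 0" by simp
  have Pl: "P * (lam + \<sigma> - 1) > real n + 4 - \<alpha>" using \<open>\<sigma> > 0 \<and> _\<close> by simp
  then have "P * (lam + \<sigma> - 1) > 0" using assms by linarith
  then have l: "lam + \<sigma> - 1 > 0" using P by (simp add: zero_less_mult_iff)
  \<comment> \<open>The critical exponent, for which the orders of source and nonlocal right-hand
    side coincide.\<close>
  define a0 where "a0 = (real n + 4 - \<alpha>) / (lam + \<sigma> - 1)"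
  have "a0 < P" "a0 > 0" using Pl l assms by (auto simp: a0_def pos_divide_less_eq)
  then obtain a where a: "a0 < a" "a < P" using dense by blast
  \<comment> \<open>The gap \<open>b - a\<close> becomes a positive power of the widths, which makes
    the series of norms converge.\<close>
  then obtain b where b: "a < b" "b < P" using dense by blast
  have "a * (lam + \<sigma> - 1) > real n + 4 - \<alpha>" using a l by (simp add: a0_def pos_divide_less_eq)
  moreover have "b < real n" "b * lam < real n + 2" using b assms by (auto simp: P_def pos_less_divide_eq)
  ultimately show "\<exists>a b. 0 < a \<and> a < b \<and> b < real n \<and> b * lam < real n + 2 \<and> a * (lam + \<sigma> - 1) > real n + 4 - \<alpha>"
    using a b \<open>a0 > 0\<close> by (meson less_trans)
qed

lemma exists_large_power:
  fixes c r L a M :: real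
  assumes "c > 0" "r > 0" "L > 1" "a > 0"
  shows "\<exists>N>0. M \<le> c * (r / L ^ N) powr (- a)"
proof -
  have "1 < L powr a" using assms by simp
  then obtain N where N: "\<bar>M\<bar> / (c * r powr (- a)) < (L powr a) ^ N" using real_arch_pow by blast
  \<comment> \<open>One further factor secures a positive number of steps.\<close>
  have "(L powr a) ^ N \<le> (L powr a) ^ Suc N"
    using \<open>1 < L powr a\<close> by (intro power_increasing) auto
  then have "\<bar>M\<bar> / (c * r powr (- a)) < (L powr a) ^ Suc N" using N by linarith
  then have "\<bar>M\<bar> < c * (r powr (- a) * (L powr a) ^ Suc N)"
    using assms by (simp add: pos_divide_less_eq mult_ac del: power_Suc)
  also have "r powr (- a) * (L powr a) ^ Suc N = (r / L ^ Suc N) powr (- a)"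
  proof -
    have "(L ^ Suc N) powr (- a) = inverse ((L powr a) ^ Suc N)"
      using assms by (simp add: powr_minus powr_powr mult.commute flip: powr_realpow del: power_Suc)
    then show ?thesis using assms powr_divide[of r "L ^ Suc N" "- a"]
      by (simp add: divide_inverse_commute mult.commute del: power_Suc)
  qed
  finally show ?thesis by (intro exI[of _ "Suc N"]) (auto simp: mult.assoc simp del: power_Suc)
qed

section \<open>The sum of all pulses\<close>

context blocks
begin

lemma sqrt_coeff_of: "sqrt (coeff_of q m) = coeff_of (q / 2) m"
  by (simp add: coeff_of_def powr_half_sqrt[symmetric] powr_powr)

lemma coeff_of_powr: "l > 0 \<Longrightarrow> coeff_of q m powr l = coeff_of (q * l) m"
  by (simp add: coeff_of_def powr_powr)

lemma coeff_of_add: "coeff_of p m * rad (row m) (col m) powr q = coeff_of (p + q) m"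
  by (simp add: coeff_of_def powr_add)

lemma suminf_coeff_of_pos: "q > 0 \<Longrightarrow> 0 < (\<Sum>m. coeff_of q m)"
  by (rule suminf_pos2[OF summable_coeff_of, of q "prod_encode (0, 0)"])
    (use rad_pos[of 0 0] in \<open>auto simp: coeff_of_def\<close>)

definition bump_sum :: "real \<Rightarrow> 'a::euclidean_space \<Rightarrow> real \<Rightarrow> real" where
  "bump_sum a = ramped_series.ser (coeff_of (real DIM('a) - a))
     (\<lambda>m. start (row m) (col m)) (\<lambda>m. rad (row m) (col m)) heat_kernel"

lemma block_le_bump_sum:
  assumes "a < real DIM('a::euclidean_space)" "k \<le> N j" "t > 0"
  shows "rad j k powr (real DIM('a) - a) * ramped heat_kernel (start j k) (rad j k) y t \<le> bump_sum a (y::'a) t"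
proof -
  interpret ramped_series "coeff_of (real DIM('a) - a)" "\<lambda>m. start (row m) (col m)" "\<lambda>m. rad (row m) (col m)"
    using assms by (intro ramped_series_blocks) simp
  let ?f = "\<lambda>m. coeff_of (real DIM('a) - a) m * ramped heat_kernel (start (row m) (col m)) (rad (row m) (col m)) y t"
  have "sum ?f {prod_encode (j, k)} \<le> suminf ?f"
    using assms by (intro sum_le_suminf summable_ramped bounded_for_late_heat_kernel)
      (auto simp: coeff_of_nonneg ramped_heat_kernel_nonneg)
  then show ?thesis using assms by (simp add: bump_sum_def ser_def coeff_of_def)
qed

text \<open>The first pulse of chain 0 starts at \<open>- (rad 0 0)\<^sup>2\<close>, so it is fully
  on at all positive times, and it bounds the sum from below.\<close>

lemma bump_sum_pos:
  assumes "a < real DIM('a::euclidean_space)" "t > 0"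
  shows "bump_sum a (x::'a) t > 0"
proof -
  have "0 < rad 0 0 powr (real DIM('a) - a) * ramped heat_kernel (start 0 0) (rad 0 0) x t"
    using assms rad_pos[of 0 0]
    by (auto simp: ramped_after intro!: mult_pos_pos heat_kernel_pos add_pos_pos)
  also have "\<dots> \<le> bump_sum a x t" using assms by (intro block_le_bump_sum) auto
  finally show ?thesis .
qed

lemma C21_on_bump_sum:
  assumes "a < real DIM('a::euclidean_space)"
  shows "C21_on {0<..<1} (bump_sum a :: 'a \<Rightarrow> _)"
proof -
  interpret ramped_series "coeff_of (real DIM('a) - a)" "\<lambda>m. start (row m) (col m)" "\<lambda>m. rad (row m) (col m)"
    using assms by (intro ramped_series_blocks) simp
  show ?thesis unfolding bump_sum_def by (rule C21_on_ser)
qed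

lemma set_integrable_bump_sum:
  assumes "0 < a" "a < b" "b < real DIM('a::euclidean_space)" "b * l < real DIM('a) + 2" "l > 0"
  shows "set_integrable lborel (UNIV \<times> {0<..<1}) (\<lambda>(y, s). \<bar>bump_sum a (y::'a) s\<bar> powr l)"
proof -
  interpret ramped_series "coeff_of (real DIM('a) - a)" "\<lambda>m. start (row m) (col m)" "\<lambda>m. rad (row m) (col m)"
    using assms by (intro ramped_series_blocks) simp
  let ?A = "UNIV \<times> {0<..<1} :: ('a \<times> real) set"
  have fin: "(\<integral>\<^sup>+p. indicator ?A p * ennreal (bump_sum a (fst p :: 'a) (snd p) powr l) \<partial>lborel) < \<infinity>"
    unfolding bump_sum_def
  \<comment> \<open>The exponent \<open>real DIM('a) - a\<close> is divided into
    \<open>b - a\<close> for the summation and \<open>real DIM('a) - b\<close> for the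
    envelope.\<close>
  proof (rule nn_integral_ser_powr_finite[where b=b and e="coeff_of (b - a)"])
    show "coeff_of (real DIM('a) - a) m = coeff_of (b - a) m * rad (row m) (col m) powr (real DIM('a) - b)" for m
      by (simp add: coeff_of_add)
    show "rad (row m) (col m) \<le> 1" for m using rad_le_R[of "row m" "col m"] R by linarith
  qed (use assms in \<open>auto simp: sqrt_coeff_of coeff_of_powr coeff_of_nonneg suminf_coeff_of_pos summable_coeff_of start_ge\<close>)
  have pos: "bump_sum a (y::'a) s > 0" if "s > 0" for y s
    using assms that by (intro bump_sum_pos) auto
  have "continuous_on ?A (\<lambda>p. bump_sum a (fst p) (snd p))"
    using C21_on_bump_sum[of a, where 'a='a] assms by (simp add: C21_on_def case_prod_unfold)
  then have "continuous_on ?A (\<lambda>p. \<bar>bump_sum a (fst p) (snd p)\<bar> powr l)"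
    using pos by (intro continuous_intros) (auto simp: less_imp_neq[symmetric])
  moreover have "?A \<in> sets borel" by (simp add: borel_Times)
  ultimately have meas: "(\<lambda>p. indicator ?A p *\<^sub>R (\<bar>bump_sum a (fst p) (snd p)\<bar> powr l)) \<in> borel_measurable borel"
    by (rule borel_measurable_continuous_on_indicator[rotated])
  show ?thesis
    unfolding set_integrable_def case_prod_unfold
  proof (rule integrableI_bounded)
    have "(\<integral>\<^sup>+p. ennreal (norm (indicator ?A p *\<^sub>R (\<bar>bump_sum a (fst p) (snd p)\<bar> powr l))) \<partial>lborel)
      = (\<integral>\<^sup>+p. indicator ?A p * ennreal (bump_sum a (fst p :: 'a) (snd p) powr l) \<partial>lborel)"
      by (intro nn_integral_cong) (auto simp: indicator_def abs_of_pos[OF pos])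
    then show "(\<integral>\<^sup>+p. ennreal (norm (indicator ?A p *\<^sub>R (\<bar>bump_sum a (fst p) (snd p)\<bar> powr l))) \<partial>lborel) < \<infinity>"
      using fin by simp
  qed (use meas in simp)
qed

text \<open>At a positive time at most one source is active, and it belongs to a pulse with a
  predecessor, to which \<open>step_inequality\<close> applies. As the exponent is positive,
  \<open>small\<close> passes from \<open>R\<close> to every smaller width.\<close>

lemma bump_sum_inequality:
  fixes x :: "'a::euclidean_space"
  assumes a: "a < real DIM('a)" and "0 < \<alpha>" "0 < lam" "0 < \<sigma>" "8 * (lam + \<sigma>) \<le> L\<^sup>2" "0 < t" "t < 1"
    and \<delta>: "a * (lam + \<sigma> - 1) > real DIM('a) + 4 - \<alpha>"
    and small: "R powr (a * (lam + \<sigma> - 1) - (real DIM('a) + 4 - \<alpha>)) \<le>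
      (hk_const DIM('a) * exp (- 1)) powr (\<alpha> / real DIM('a) + lam + \<sigma>) * unit_ball_vol DIM('a) / (4 * L powr (a + 2))"
  shows "0 \<le> pdt (bump_sum a) x t - laplacian (bump_sum a) x t"
    and "ennreal (pdt (bump_sum a) x t - laplacian (bump_sum a) x t) \<le>
      (\<integral>\<^sup>+ p. indicator (UNIV \<times> {0<..<1}) p *
          ennreal (heat_kernel (x - fst p) (t - snd p) powr (\<alpha> / real DIM('a))
                   * bump_sum a (fst p) (snd p) powr lam) \<partial>lborel) * ennreal (bump_sum a x t powr \<sigma>)"
    (is "_ \<le> ?RHS")
proof -
  interpret ramped_series "coeff_of (real DIM('a) - a)" "\<lambda>m. start (row m) (col m)" "\<lambda>m. rad (row m) (col m)"
    using a by (intro ramped_series_blocks) simp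
  let ?f = "\<lambda>m. coeff_of (real DIM('a) - a) m * source (start (row m) (col m)) (rad (row m) (col m)) x t"
  have op: "pdt (bump_sum a) x t - laplacian (bump_sum a) x t = suminf ?f"
    unfolding bump_sum_def heat_operator_ser[OF \<open>0 < t\<close>] src_def ..
  show "0 \<le> pdt (bump_sum a) x t - laplacian (bump_sum a) x t"
    unfolding op by (intro suminf_nonneg summable_source) (auto simp: assms coeff_of_nonneg source_nonneg)
  show "ennreal (pdt (bump_sum a) x t - laplacian (bump_sum a) x t) \<le> ?RHS"
  proof (cases "\<exists>m. ?f m \<noteq> 0")
    case False
    then have "?f = (\<lambda>_. 0)" by blast
    then show ?thesis unfolding op by (simp only: suminf_zero) simp
  next
    case True
    then obtain m where m: "?f m \<noteq> 0" by blast
    have supp: "start (row m) (col m) < t \<and> t < start (row m) (col m) + (rad (row m) (col m))\<^sup>2" if "?f m \<noteq> 0" for m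
    proof (rule ccontr)
      assume "\<not> ?thesis"
      then have "source (start (row m) (col m)) (rad (row m) (col m)) x t = 0"
        using rad_pos by auto
      then show False using that by simp
    qed
    have "?f m' = 0" if "m' \<noteq> m" for m'
    proof (rule ccontr)
      assume "?f m' \<noteq> 0"
      then have "row m' = row m \<and> col m' = col m"
        using supp[of m'] supp[OF m] \<open>0 < t\<close> by (intro block_times_disjoint[of _ _ t]) auto
      then show False using that row_col_inj by blast
    qed
    then have "suminf ?f = sum ?f {m}" by (intro suminf_finite) auto
    then have f: "suminf ?f = ?f m" by simp
    define j where "j = row m"
    \<comment> \<open>The source of a first pulse is active at negative times only.\<close>
    have "col m \<noteq> 0"
      using supp[OF m] \<open>0 < t\<close> by (cases "col m") auto
    then obtain k where k: "col m = Suc k" using not0_implies_Suc by blast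
    have kN: "Suc k \<le> N j" using m by (auto simp: coeff_of_def k j_def split: if_splits)
    have fm: "?f m = (rad j k / L) powr (real DIM('a) - a) * source (start j k + 2 * (rad j k)\<^sup>2) (rad j k / L) x t"
      using kN by (simp add: coeff_of_def k j_def[symmetric] rad_Suc)
    have t: "start j k + 2 * (rad j k)\<^sup>2 < t" "t < start j k + 2 * (rad j k)\<^sup>2 + (rad j k / L)\<^sup>2"
      using supp[OF m] by (auto simp: k j_def[symmetric] rad_Suc)
    have quarter: "(1/2)\<^sup>2 = (1/4 :: real)" by (simp add: power_one_over)
    have "(rad j 0)\<^sup>2 \<le> (1/2)\<^sup>2"
      using rad_le_R[of j 0] rad_pos[of j 0] R by (intro power_mono) auto
    then have s1: "start j k + 2 * (rad j k)\<^sup>2 \<le> 1"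
      using start_le[of j k] zero_le_power2[of "rad j k"] unfolding quarter by linarith
    have "rad j k powr (a * (lam + \<sigma> - 1) - (real DIM('a) + 4 - \<alpha>)) \<le>
        R powr (a * (lam + \<sigma> - 1) - (real DIM('a) + 4 - \<alpha>))"
      using \<delta> rad_le_R[of j k] rad_pos[of j k] by (intro powr_mono2) auto
    then have small': "rad j k powr (a * (lam + \<sigma> - 1) - (real DIM('a) + 4 - \<alpha>)) \<le>
      (hk_const DIM('a) * exp (- 1)) powr (\<alpha> / real DIM('a) + lam + \<sigma>) * unit_ball_vol DIM('a) / (4 * L powr (a + 2))"
      using small by linarith
    show ?thesis
      unfolding op f fm
    proof (rule step_inequality)
      show "rad j k powr (real DIM('a) - a) * ramped heat_kernel (start j k) (rad j k) y q \<le> bump_sum a (y::'a) q"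
        if "0 < q" for y q
        using a kN that by (intro block_le_bump_sum) auto
    qed (use assms t s1 small' L rad_pos[of j k] start_ge[of j k] in simp_all)
  qed
qed

text \<open>\<open>T\<close> is the time at which the last pulse of chain \<open>j\<close> is fully
  on; its age is then twice the square of its width, whence the \<open>8 * pi\<close>. The bounds on
  \<open>T\<close> do not involve \<open>N j\<close>, which can therefore be chosen with these times
  already confined.\<close>

lemma bump_sum_peak:
  assumes "a < real DIM('a::euclidean_space)" "N j > 0"
  defines "T \<equiv> start j (N j) + (rad j (N j))\<^sup>2"
  shows "(rad j 0)\<^sup>2 \<le> T" "T \<le> 2 * (rad j 0)\<^sup>2"
    and "(8 * pi) powr (- real DIM('a) / 2) * rad j (N j) powr (- a) \<le> bump_sum a (0::'a) T"
proof -
  show T: "(rad j 0)\<^sup>2 \<le> T" unfolding T_def using start_pos[OF assms(2), of j] zero_le_power2[of "rad j (N j)"] by linarith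
  show "T \<le> 2 * (rad j 0)\<^sup>2"
    unfolding T_def using start_le[of j "N j"] zero_le_power2[of "rad j (N j)"] by linarith
  let ?r = "rad j (N j)"
  have "T > 0" using T rad_pos[of j 0] by (smt (verit) zero_less_power)
  have "ramped heat_kernel (start j (N j)) ?r (0::'a) T = (8 * pi * ?r\<^sup>2) powr (- real DIM('a) / 2)"
    using rad_pos[of j "N j"] by (simp add: ramped_after T_def heat_kernel_def mult_ac)
  also have "\<dots> = (8 * pi) powr (- real DIM('a) / 2) * ?r powr (- real DIM('a))"
    using rad_pos[of j "N j"] by (intro square_powr_half) auto
  finally have "?r powr (real DIM('a) - a) * ramped heat_kernel (start j (N j)) ?r (0::'a) T =
      (8 * pi) powr (- real DIM('a) / 2) * (?r powr (real DIM('a) - a) * ?r powr (- real DIM('a)))"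
    by simp
  also have "?r powr (real DIM('a) - a) * ?r powr (- real DIM('a)) = ?r powr (- a)"
    unfolding powr_add[symmetric] by simp
  finally show "(8 * pi) powr (- real DIM('a) / 2) * ?r powr (- a) \<le> bump_sum a (0::'a) T"
    using block_le_bump_sum[OF assms(1), of "N j" j T 0] \<open>T > 0\<close> by simp
qed

end

section \<open>Choice of the constants and of the chain lengths\<close>

theorem theorem1p3:
  fixes \<alpha> lam \<sigma> :: real and \<phi> :: "real \<Rightarrow> real"
  assumes "0 < \<alpha>" "\<alpha> < real DIM('a::euclidean_space) + 2"
    and "lam > 0"
    and "\<sigma> > G_alpha DIM('a) \<alpha> lam"
    and "continuous_on {0<..<1} \<phi>"
    and "\<forall>t\<in>{0<..<1}. \<phi> t > 0"
    and "filterlim \<phi> at_top (at_right 0)"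
  shows "\<exists>u :: 'a \<Rightarrow> real \<Rightarrow> real.
     (\<forall>x. \<forall>t\<in>{0<..<1}. u x t > 0) \<and>
     C21_on {0<..<1} u \<and>
     set_integrable lborel (UNIV \<times> {0<..<1}) (\<lambda>(y, s). \<bar>u y s\<bar> powr lam) \<and>
     (\<forall>x. \<forall>t\<in>{0<..<1}.
        0 \<le> pdt u x t - laplacian u x t \<and>
        ennreal (pdt u x t - laplacian u x t) \<le>
          (\<integral>\<^sup>+ p. indicator (UNIV \<times> {0<..<1}) p *
              ennreal (heat_kernel (x - fst p) (t - snd p) powr (\<alpha> / real DIM('a))
                       * u (fst p) (snd p) powr lam) \<partial>lborel)
          * ennreal (u x t powr \<sigma>)) \<and>
     (\<lambda>t. u 0 t) \<notin> O[at_right 0](\<phi>)"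
proof -
  have \<sigma>: "\<sigma> > 0"
    using exists_exponents(1)[OF DIM_positive[where 'a='a] assms(1-4)] .
  obtain a b where ab: "0 < a" "a < b" "b < real DIM('a)" "b * lam < real DIM('a) + 2"
    and \<delta>0: "a * (lam + \<sigma> - 1) > real DIM('a) + 4 - \<alpha>"
    using exists_exponents(2)[OF DIM_positive[where 'a='a] assms(1-4)] by blast
  define \<delta> where "\<delta> = a * (lam + \<sigma> - 1) - (real DIM('a) + 4 - \<alpha>)"
  \<comment> \<open>This \<open>L\<close> is at least 2, hence
    \<open>L\<^sup>2 \<ge> L \<ge> 8 * (lam + \<sigma>)\<close>.\<close>
  define L where "L = 2 + 8 * (lam + \<sigma>)"
  define C where "C = (hk_const DIM('a) * exp (- 1)) powr (\<alpha> / real DIM('a) + lam + \<sigma>) *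
    unit_ball_vol DIM('a) / (4 * L powr (a + 2))"
  \<comment> \<open>The largest width up to 1/2 with \<open>R powr \<delta> \<le> C\<close>, the
    smallness condition of the concentration step.\<close>
  define R where "R = min (1/2) (C powr (1 / \<delta>))"
  define c where "c = (8 * pi) powr (- real DIM('a) / 2)"
  have \<delta>: "\<delta> > 0" using \<delta>0 by (simp add: \<delta>_def)
  have L: "L \<ge> 2" using assms \<sigma> by (simp add: L_def)
  have L2: "8 * (lam + \<sigma>) \<le> L\<^sup>2"
  proof -
    have "8 * (lam + \<sigma>) \<le> L" by (simp add: L_def)
    also have "L \<le> L\<^sup>2" using L by (simp add: power2_eq_square)
    finally show ?thesis .
  qed
  have C: "C > 0"
    unfolding C_def using L hk_const_pos[of "DIM('a)"]
    by (intro divide_pos_pos mult_pos_pos unit_ball_vol_pos) auto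
  have R: "0 < R" "R \<le> 1/2" using C by (auto simp: R_def)
  have "R powr \<delta> \<le> (C powr (1 / \<delta>)) powr \<delta>"
    using R \<delta> by (intro powr_mono2) (auto simp: R_def)
  then have small: "R powr \<delta> \<le> C" using \<delta> C by (simp add: powr_powr)
  \<comment> \<open>The peak time depends on the chain length but always lies in this compact
    interval. It is therefore enough that the height of the last pulse exceed
    \<open>real j + 1\<close> times a bound of \<open>\<phi>\<close> on the whole interval.\<close>
  have "\<exists>K>0. (\<forall>t\<in>{(R / 2 ^ j)\<^sup>2..2 * (R / 2 ^ j)\<^sup>2}. (real j + 1) * \<phi> t \<le> c * (R / 2 ^ j / L ^ K) powr (- a))" for j
  proof -
    let ?S = "{(R / 2 ^ j)\<^sup>2..2 * (R / 2 ^ j)\<^sup>2}"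
    have "R / 2 ^ j \<le> R / 1" using R by (intro divide_left_mono) auto
    then have "R / 2 ^ j \<le> 1/2" using R by linarith
    then have "(R / 2 ^ j)\<^sup>2 \<le> (1/2)\<^sup>2" using R by (intro power_mono) auto
    moreover have "0 < (R / 2 ^ j)\<^sup>2" using R by simp
    moreover have "(1/2)\<^sup>2 = (1/4 :: real)" by (simp add: power_one_over)
    ultimately have "0 < (R / 2 ^ j)\<^sup>2" "2 * (R / 2 ^ j)\<^sup>2 < 1" by linarith+
    then have "?S \<subseteq> {0<..<1}" by (meson atLeastAtMost_subseteq_atLeastLessThan_iff atLeastAtMost_iff
        greaterThanLessThan_iff less_le_trans le_less_trans subsetI)
    then have "continuous_on ?S \<phi>" using assms(5) continuous_on_subset by blast
    then have "bounded (\<phi> ` ?S)" by (intro compact_imp_bounded compact_continuous_image) auto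
    then obtain M where M: "\<forall>t\<in>?S. \<bar>\<phi> t\<bar> \<le> M" unfolding bounded_iff by auto
    obtain K where K: "K > 0" "(real j + 1) * M \<le> c * (R / 2 ^ j / L ^ K) powr (- a)"
      using exists_large_power[of c "R / 2 ^ j" L a "(real j + 1) * M"] R L ab by (auto simp: c_def)
    have "(real j + 1) * \<phi> t \<le> (real j + 1) * M" if "t \<in> ?S" for t
      using bspec[OF M that] by (intro mult_left_mono) auto
    then show ?thesis using K by (meson order.trans)
  qed
  then obtain N where N: "\<And>j. N j > 0"
    "\<And>j t. t \<in> {(R / 2 ^ j)\<^sup>2..2 * (R / 2 ^ j)\<^sup>2} \<Longrightarrow> (real j + 1) * \<phi> t \<le> c * (R / 2 ^ j / L ^ N j) powr (- a)"
    by metis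
  interpret blocks R L N by unfold_locales (use R L in auto)
  have a: "a < real DIM('a)" using ab by simp
  have big: "(\<lambda>t. bump_sum a (0::'a) t) \<notin> O[at_right 0](\<phi>)"
  proof
    assume "(\<lambda>t. bump_sum a (0::'a) t) \<in> O[at_right 0](\<phi>)"
    then obtain c' where "\<forall>\<^sub>F t in at_right 0. norm (bump_sum a (0::'a) t) \<le> c' * norm (\<phi> t)"
      by (auto elim: landau_o.bigE)
    then obtain h where h: "h > 0" "\<And>t. 0 < t \<Longrightarrow> t < h \<Longrightarrow> \<bar>bump_sum a (0::'a) t\<bar> \<le> c' * \<bar>\<phi> t\<bar>"
      unfolding eventually_at_right_field by auto
    have "(\<lambda>j. 2 * (R * (1/2) ^ j)\<^sup>2) \<longlonglongrightarrow> 2 * (R * 0)\<^sup>2"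
      by (intro tendsto_intros LIMSEQ_realpow_zero) auto
    then have "\<forall>\<^sub>F j in sequentially. 2 * (R * (1/2) ^ j)\<^sup>2 < min h 1"
      using h by (intro order_tendstoD(2)) auto
    moreover have "\<forall>\<^sub>F j in sequentially. real j \<ge> c'"
      using filterlim_real_sequentially unfolding filterlim_at_top by blast
    ultimately have "\<forall>\<^sub>F j in sequentially. 2 * (R * (1/2) ^ j)\<^sup>2 < min h 1 \<and> real j \<ge> c'"
      by (rule eventually_conj)
    \<comment> \<open>The first condition brings the peak time of chain \<open>j\<close> below
      \<open>h\<close>; the second makes \<open>(real j + 1) * \<phi> T \<le> c' * \<phi> T\<close>
      impossible.\<close>
    then obtain j where j: "2 * (R * (1/2) ^ j)\<^sup>2 < min h 1" "real j \<ge> c'"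
      using eventually_happens'[OF sequentially_bot] by blast
    have r0: "R * (1/2) ^ j = R / 2 ^ j" "rad j 0 = R / 2 ^ j" by (auto simp: rad_def power_one_over)
    define T where "T = start j (N j) + (rad j (N j))\<^sup>2"
    note peak = bump_sum_peak[OF a N(1)[of j], folded T_def, unfolded r0]
    have "(R / 2 ^ j)\<^sup>2 > 0" using R by simp
    then have T: "0 < T" "T < h" "T < 1" using peak(1,2) j(1) unfolding r0 min_less_iff_conj by linarith+
    have pos: "\<phi> T > 0" using assms(6) T by simp
    have "(real j + 1) * \<phi> T \<le> c * rad j (N j) powr (- a)"
      using N(2)[of T j] peak(1,2) by (simp add: rad_def)
    also have "\<dots> \<le> bump_sum a (0::'a) T" using peak(3) by (simp add: c_def)
    also have "\<dots> \<le> c' * \<phi> T" using h(2)[OF T(1,2)] pos by simp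
    also have "\<dots> \<le> real j * \<phi> T" using j(2) pos by (intro mult_right_mono) auto
    finally show False using pos by (simp add: algebra_simps)
  qed
  show ?thesis
  proof (intro exI[of _ "bump_sum a :: 'a \<Rightarrow> _"] conjI allI ballI)
    show "bump_sum a x t > 0" if "t \<in> {0<..<1}" for x :: 'a and t
      using that a by (intro bump_sum_pos) auto
    show "C21_on {0<..<1} (bump_sum a :: 'a \<Rightarrow> _)" using a by (rule C21_on_bump_sum)
    show "set_integrable lborel (UNIV \<times> {0<..<1}) (\<lambda>(y, s). \<bar>bump_sum a (y::'a) s\<bar> powr lam)"
      using ab assms(3) by (intro set_integrable_bump_sum)
    fix x :: 'a and t :: real assume "t \<in> {0<..<1}"
    then have t: "0 < t" "t < 1" by auto
    note ineq = bump_sum_inequality[OF a assms(1,3) \<sigma> L2 t \<delta>0 small[unfolded \<delta>_def C_def], of x]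
    show "0 \<le> pdt (bump_sum a) x t - laplacian (bump_sum a) x t" by (rule ineq(1))
    show "ennreal (pdt (bump_sum a) x t - laplacian (bump_sum a) x t) \<le>
        (\<integral>\<^sup>+ p. indicator (UNIV \<times> {0<..<1}) p *
            ennreal (heat_kernel (x - fst p) (t - snd p) powr (\<alpha> / real DIM('a))
                     * bump_sum a (fst p) (snd p) powr lam) \<partial>lborel)
        * ennreal (bump_sum a x t powr \<sigma>)" by (rule ineq(2))
  qed (rule big)
qed

end
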